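(* Let $X,Y$ be diagonal metric spaces. Then the product $X\times Y$ with the $\ell^1$ metric $d((x,y),(x',y'))=d(x,x')+d(y,y')$ is diagonal.
   Context: Metric spaces have a finite, symmetric, non-degenerate distance satisfying the triangle inequality. A point $z$ is between $x$ and $y$ if $d(x,y)=d(x,z)+d(z,y)$, strictly between if moreover $z\neq x,y$; $]x,y[$ is the set of points strictly between $x$ and $y$. A $k$-path ($k\ge0$) in $X$ is a sequence $\langle x_0,\dots,x_k\rangle$ of points of $X$ with $x_i\ne x_{i+1}$ for $0\le i<k$; it is saturated if each $]x_i,x_{i+1}[$ is empty. Magnitude complex: $\mathrm{MC}_k(X)$ is the free abelian group on the $k$-paths of $X$, with boundary $\partial_k=\sum_{i=1}^{k-1}(-1)^i\partial_{k,i}$, where $\partial_{k,i}\langle x_0,\dots,x_k\rangle=\langle x_0,\dots,\widehat{x_i},\dots,x_k\rangle$ if $x_i$ is between $x_{i-1}$ and $x_{i+1}$, and $0$ otherwise. $\mathrm{MH}_*(X)$ is its homology. $X$ is diagonal if for every $k$, $\mathrm{MH}_k(X)$ is generated by classes of cycles that are integral linear combinations of saturated $k$-paths of $X$. *)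

theory Defs
  imports "HOL-Analysis.Abstract_Metric_Spaces" "HOL-Algebra.Free_Abelian_Groups"
begin

section \<open>Betweenness and paths\<close>

definition between :: "('a \<Rightarrow> 'a \<Rightarrow> real) \<Rightarrow> 'a \<Rightarrow> 'a \<Rightarrow> 'a \<Rightarrow> bool" where
  "between d x z y \<longleftrightarrow> d x y = d x z + d z y"

definition strictly_between_set :: "'a set \<Rightarrow> ('a \<Rightarrow> 'a \<Rightarrow> real) \<Rightarrow> 'a \<Rightarrow> 'a \<Rightarrow> 'a set" where
  "strictly_between_set X d x y = {z \<in> X. between d x z y \<and> z \<noteq> x \<and> z \<noteq> y}"

text \<open>The path \<open>\<langle>x\<^sub>0, \<dots>, x\<^sub>k\<rangle>\<close> is encoded as the list of its \<open>k + 1\<close> points.\<close>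

definition paths :: "'a set \<Rightarrow> nat \<Rightarrow> 'a list set" where
  "paths X k = {p. length p = k + 1 \<and> set p \<subseteq> X \<and> (\<forall>i<k. p ! i \<noteq> p ! (i + 1))}"

definition saturated_paths :: "'a set \<Rightarrow> ('a \<Rightarrow> 'a \<Rightarrow> real) \<Rightarrow> nat \<Rightarrow> 'a list set" where
  "saturated_paths X d k =
     {p \<in> paths X k. \<forall>i<k. strictly_between_set X d (p ! i) (p ! (i + 1)) = {}}"

section \<open>Magnitude complex and magnitude homology\<close>

abbreviation magnitude_chain_group :: "'a set \<Rightarrow> nat \<Rightarrow> ('a list \<Rightarrow>\<^sub>0 int) monoid" where
  "magnitude_chain_group X k \<equiv> free_Abelian_group (paths X k)"

text \<open>Used only for \<open>1 \<le> i \<le> k - 1\<close>, where \<open>p\<close> has \<open>k + 1\<close> points.\<close>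

definition magnitude_face :: "('a \<Rightarrow> 'a \<Rightarrow> real) \<Rightarrow> nat \<Rightarrow> 'a list \<Rightarrow> ('a list \<Rightarrow>\<^sub>0 int)" where
  "magnitude_face d i p =
     (if between d (p ! (i - 1)) (p ! i) (p ! (i + 1))
      then frag_of (take i p @ drop (i + 1) p) else 0)"

text \<open>The linear extension to chains; for \<open>k = 0\<close> and \<open>k = 1\<close> the sum is empty, so that the
  boundary is zero.\<close>

definition magnitude_boundary ::
    "('a \<Rightarrow> 'a \<Rightarrow> real) \<Rightarrow> nat \<Rightarrow> ('a list \<Rightarrow>\<^sub>0 int) \<Rightarrow> ('a list \<Rightarrow>\<^sub>0 int)" where
  "magnitude_boundary d k =
     frag_extend (\<lambda>p. \<Sum>i\<in>{1..<k}. frag_cmul ((-1) ^ i) (magnitude_face d i p))"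

definition magnitude_cycles :: "'a set \<Rightarrow> ('a \<Rightarrow> 'a \<Rightarrow> real) \<Rightarrow> nat \<Rightarrow> ('a list \<Rightarrow>\<^sub>0 int) set" where
  "magnitude_cycles X d k =
     {c \<in> carrier (magnitude_chain_group X k). magnitude_boundary d k c = 0}"

definition magnitude_boundaries :: "'a set \<Rightarrow> ('a \<Rightarrow> 'a \<Rightarrow> real) \<Rightarrow> nat \<Rightarrow> ('a list \<Rightarrow>\<^sub>0 int) set" where
  "magnitude_boundaries X d k =
     magnitude_boundary d (k + 1) ` carrier (magnitude_chain_group X (k + 1))"

definition magnitude_cycle_group ::
    "'a set \<Rightarrow> ('a \<Rightarrow> 'a \<Rightarrow> real) \<Rightarrow> nat \<Rightarrow> ('a list \<Rightarrow>\<^sub>0 int) monoid" where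
  "magnitude_cycle_group X d k =
     (magnitude_chain_group X k)\<lparr>carrier := magnitude_cycles X d k\<rparr>"

definition magnitude_homology ::
    "'a set \<Rightarrow> ('a \<Rightarrow> 'a \<Rightarrow> real) \<Rightarrow> nat \<Rightarrow> ('a list \<Rightarrow>\<^sub>0 int) set monoid" where
  "magnitude_homology X d k = magnitude_cycle_group X d k Mod magnitude_boundaries X d k"

definition homology_class ::
    "'a set \<Rightarrow> ('a \<Rightarrow> 'a \<Rightarrow> real) \<Rightarrow> nat \<Rightarrow> ('a list \<Rightarrow>\<^sub>0 int) \<Rightarrow> ('a list \<Rightarrow>\<^sub>0 int) set" where
  "homology_class X d k c = magnitude_boundaries X d k #>\<^bsub>magnitude_cycle_group X d k\<^esub> c"

section \<open>Diagonality and the product metric\<close>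

definition diagonal :: "'a set \<Rightarrow> ('a \<Rightarrow> 'a \<Rightarrow> real) \<Rightarrow> bool" where
  "diagonal X d \<longleftrightarrow>
     (\<forall>k. carrier (magnitude_homology X d k) =
        generate (magnitude_homology X d k)
          (homology_class X d k `
             (magnitude_cycles X d k \<inter> carrier (free_Abelian_group (saturated_paths X d k)))))"

definition l1_dist ::
    "('a \<Rightarrow> 'a \<Rightarrow> real) \<Rightarrow> ('b \<Rightarrow> 'b \<Rightarrow> real) \<Rightarrow> 'a \<times> 'b \<Rightarrow> 'a \<times> 'b \<Rightarrow> real" where
  "l1_dist dX dY = (\<lambda>(x, y) (x', y'). dX x x' + dY y y')"

lemma Metric_space_l1_dist:
  assumes "Metric_space X dX" "Metric_space Y dY"
  shows "Metric_space (X \<times> Y) (l1_dist dX dY)"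
proof -
  interpret X: Metric_space X dX by fact
  interpret Y: Metric_space Y dY by fact
  show ?thesis
  proof
    show "0 \<le> l1_dist dX dY p q" for p q
      by (simp add: l1_dist_def split: prod.splits)
    show "l1_dist dX dY p q = l1_dist dX dY q p" for p q
      by (simp add: l1_dist_def X.commute Y.commute split: prod.splits)
    show "l1_dist dX dY p q = 0 \<longleftrightarrow> p = q" if "p \<in> X \<times> Y" "q \<in> X \<times> Y" for p q
      using that by (auto simp: l1_dist_def add_nonneg_eq_0_iff)
    show "l1_dist dX dY p r \<le> l1_dist dX dY p q + l1_dist dX dY q r"
      if "p \<in> X \<times> Y" "q \<in> X \<times> Y" "r \<in> X \<times> Y" for p q r
    proof -
      obtain a b c e f g where "p = (a, b)" "q = (c, e)" "r = (f, g)"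
        by (metis surj_pair)
      with that X.triangle [of a c f] Y.triangle [of b e g] show ?thesis
        by (simp add: l1_dist_def)
    qed
  qed
qed

end

theory Submission
  imports Defs
begin

text \<open>The theorem is a Kuenneth formula for the classes of saturated cycles. A boundary never contains a
saturated path, because removing a point creates a gap with that point inside. Hence the space
\<open>X\<close> is diagonal exactly when every cycle is uniquely the sum of a saturated cycle and a
boundary (\<open>diagonal_iff\<close>, \<open>saturated_boundary_eq_0\<close>). It remains to move an arbitrary cycle of
\<open>X \<times> Y\<close> to a saturated one by adding boundaries. This happens in two stages, linked by the tensor
product of the two magnitude complexes, here realised on pairs of paths, and by the shuffle product.
The shuffle product of paths \<open>p\<close> of \<open>X\<close> and \<open>q\<close> of \<open>Y\<close> is the signed sum of the paths of
\<open>X \<times> Y\<close> that interleave the steps of \<open>p\<close> with those of \<open>q\<close>. It is a chain map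
(\<open>bd_shuffle\<close>), and it takes pairs of saturated paths to saturated paths, since a step in one
coordinate direction has an empty gap as soon as its projection has one (\<open>shuffle_saturated\<close>).

Stage one: every cycle of \<open>X \<times> Y\<close> is homologous to the shuffle image of a cycle of the tensor
complex (\<open>cycle_homologous_to_shuffles\<close>). In the \<open>\<ell>\<^sup>1\<close> metric a diagonal step from \<open>(x, y)\<close> to
\<open>(x', y')\<close> always has the corner \<open>(x, y')\<close> between its ends. Inserting this corner at the
first obstruction to a path being of the shape ``horizontal steps, then vertical steps'' defines an
acyclic matching in the sense of discrete Morse theory. It pairs each path whose first obstruction
is a diagonal step (a lower path) with one whose first obstruction is a horizontal step after a
vertical one (an upper path). The unmatched paths are the straight ones, which correspond to pairs
\<open>(p, q)\<close>. Modulo boundaries the lower paths disappear (\<open>chain_reducible\<close>). What is left of a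
cycle after subtracting the shuffles of its straight part is carried by upper paths, and such a
chain is \<open>0\<close> if no lower path occurs in its boundary (\<open>upper_chain_eq_0\<close>).

Stage two: every cycle of the tensor complex is homologous to a combination of pairs of saturated
paths (\<open>tensor_cycle_saturated\<close>). Write the cycle as a sum of \<open>t\<^sub>q \<otimes> q\<close> over paths \<open>q\<close> of \<open>Y\<close>.
Proceeding from the longest \<open>q\<close> downwards, the boundary of \<open>t\<^sub>q\<close> is saturated and hence vanishes,
so diagonality of \<open>X\<close> turns \<open>t\<^sub>q\<close> into a saturated cycle up to a boundary
(\<open>saturate_left\<close>). After that the cycle lies
in the tensor product of the group of saturated cycles of \<open>X\<close> with the complex of \<open>Y\<close>. Only
finitely many paths of \<open>X\<close> occur, and eliminating them one at a time, as in the proof that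
subgroups of \<open>\<int>\<^sup>n\<close> are free, writes it as a sum of \<open>u \<otimes> s\<close> with \<open>u\<close> a saturated cycle of
\<open>X\<close> and \<open>s\<close> a cycle of \<open>Y\<close>, to which diagonality of \<open>Y\<close> applies (\<open>saturate_right\<close>).\<close>


section \<open>Integral chains\<close>

abbreviation keys :: "('a \<Rightarrow>\<^sub>0 int) \<Rightarrow> 'a set" where "keys \<equiv> Poly_Mapping.keys"
abbreviation lookup :: "('a \<Rightarrow>\<^sub>0 int) \<Rightarrow> 'a \<Rightarrow> int" where "lookup \<equiv> Poly_Mapping.lookup"

lemma frag_extend_keysE:
  assumes "y \<in> keys (frag_extend f c)"
  obtains x where "x \<in> keys c" "y \<in> keys (f x)"
  using assms keys_frag_extend[of f c] by blast

lemma keys_diffE: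
  assumes "y \<in> keys (a - b)" obtains "y \<in> keys a" | "y \<in> keys b"
  using assms keys_diff[of a b] by blast

lemma keys_addE:
  assumes "y \<in> keys (a + b)" obtains "y \<in> keys a" | "y \<in> keys (b :: 'a \<Rightarrow>\<^sub>0 int)"
  using assms keys_add[of a b] by blast

lemma keys_diff_subset: "keys a \<subseteq> S \<Longrightarrow> keys b \<subseteq> S \<Longrightarrow> keys (a - b :: 'b \<Rightarrow>\<^sub>0 int) \<subseteq> S"
  using keys_diff[of a b] by blast

lemma keys_add_subset: "keys a \<subseteq> S \<Longrightarrow> keys b \<subseteq> S \<Longrightarrow> keys (a + b :: 'b \<Rightarrow>\<^sub>0 int) \<subseteq> S"
  using keys_add[of a b] by blast

lemma lookup_frag_extend:
  "lookup (frag_extend f c) y = (\<Sum>x\<in>keys c. lookup c x * lookup (f x) y)"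
  by (simp add: frag_extend_def lookup_sum)

lemma frag_cmul_diff_distrib2: "frag_cmul c (a - b) = frag_cmul c a - frag_cmul c b"
  by (rule poly_mapping_eqI) (simp add: lookup_minus algebra_simps)

lemma frag_cmul_minus2: "frag_cmul c (- a) = - frag_cmul c a"
  by (rule poly_mapping_eqI) simp

section \<open>The boundary operator\<close>

definition cons_chain :: "'a \<Rightarrow> ('a list \<Rightarrow>\<^sub>0 int) \<Rightarrow> ('a list \<Rightarrow>\<^sub>0 int)" where
  "cons_chain x = frag_extend (\<lambda>l. frag_of (x # l))"

lemma cons_chain_simps [simp]:
  "cons_chain x 0 = 0"
  "cons_chain x (frag_of l) = frag_of (x # l)"
  "cons_chain x (a - b) = cons_chain x a - cons_chain x b"
  "cons_chain x (a + b) = cons_chain x a + cons_chain x b"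
  "cons_chain x (- a) = - cons_chain x a"
  "cons_chain x (frag_cmul n a) = frag_cmul n (cons_chain x a)"
  by (simp_all add: cons_chain_def frag_extend_diff frag_extend_add frag_extend_minus
      frag_extend_cmul)

lemma cons_chain_sum: "cons_chain x (sum f I) = (\<Sum>i\<in>I. cons_chain x (f i))"
  by (induction I rule: infinite_finite_induct) simp_all

lemma keys_cons_chain: "keys (cons_chain x c) \<subseteq> (#) x ` keys c"
  unfolding cons_chain_def using keys_frag_extend[of "\<lambda>l. frag_of (x # l)" c] by auto

text \<open>The boundary by recursion on the front of the path: either the second point is removed, or a face of
the tail is taken, with all signs reversed. The lemma \<open>magnitude_boundary_eq_bd\<close> identifies its
linear extension \<open>bd\<close> with the boundary of the magnitude complex, in all degrees at once.\<close>

fun path_bd :: "('a \<Rightarrow> 'a \<Rightarrow> real) \<Rightarrow> 'a list \<Rightarrow> ('a list \<Rightarrow>\<^sub>0 int)" where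
  "path_bd d (x # y # z # r) =
     - (if between d x y z then frag_of (x # z # r) else 0) - cons_chain x (path_bd d (y # z # r))"
| "path_bd d _ = 0"

definition bd :: "('a \<Rightarrow> 'a \<Rightarrow> real) \<Rightarrow> ('a list \<Rightarrow>\<^sub>0 int) \<Rightarrow> ('a list \<Rightarrow>\<^sub>0 int)" where
  "bd d = frag_extend (path_bd d)"

lemma bd_simps [simp]:
  "bd d 0 = 0"
  "bd d (frag_of p) = path_bd d p"
  "bd d (a - b) = bd d a - bd d b"
  "bd d (a + b) = bd d a + bd d b"
  "bd d (- a) = - bd d a"
  "bd d (frag_cmul n a) = frag_cmul n (bd d a)"
  by (simp_all add: bd_def frag_extend_diff frag_extend_add frag_extend_minus
      frag_extend_cmul)

lemma magnitude_face_Cons: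
  assumes "1 \<le> i"
  shows "magnitude_face d (Suc i) (x # l) = cons_chain x (magnitude_face d i l)"
  using assms by (cases i) (auto simp: magnitude_face_def)

lemma path_bd_eq_sum:
  "path_bd d p = (\<Sum>i\<in>{1..<length p - 1}. frag_cmul ((-1) ^ i) (magnitude_face d i p))"
proof (induction d p rule: path_bd.induct)
  case (1 d x y z r)
  let ?l = "y # z # r" and ?n = "length r + 1"
  have "(\<Sum>i\<in>{1..<Suc ?n}. frag_cmul ((-1) ^ i) (magnitude_face d i (x # ?l)))
      = frag_cmul (-1) (magnitude_face d 1 (x # ?l))
        + (\<Sum>i\<in>{1..<?n}. frag_cmul ((-1) ^ Suc i) (magnitude_face d (Suc i) (x # ?l)))"
    by (subst sum.atLeast_Suc_lessThan) (simp_all add: sum.shift_bounds_Suc_ivl del: sum.op_ivl_Suc)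
  also have "(\<Sum>i\<in>{1..<?n}. frag_cmul ((-1) ^ Suc i) (magnitude_face d (Suc i) (x # ?l)))
      = - cons_chain x (path_bd d ?l)"
    by (simp add: 1 cons_chain_sum magnitude_face_Cons flip: sum_negf)
  finally show ?case
    by (simp add: magnitude_face_def)
qed auto

lemma magnitude_boundary_eq_bd:
  assumes "\<And>p. p \<in> keys c \<Longrightarrow> length p = k + 1"
  shows "magnitude_boundary d k c = bd d c"
  unfolding magnitude_boundary_def bd_def
  by (rule frag_extend_eq) (simp add: path_bd_eq_sum assms)

lemma path_bd_keysE:
  assumes "q \<in> keys (path_bd d p)"
  obtains A a m b B where "p = A @ a # m # b # B" "q = A @ a # b # B" "between d a m b"
  using assms
proof (induction d p arbitrary: q thesis rule: path_bd.induct)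
  case (1 d x y z r)
  from 1(3) consider "between d x y z" "q = x # z # r"
    | "q \<in> keys (cons_chain x (path_bd d (y # z # r)))"
    by (auto elim!: keys_diffE split: if_splits)
  then show ?case
  proof cases
    case 1
    then show ?thesis using "1.prems"(1)[of "[]" x y z r] by simp
  next
    case 2
    then obtain q' where q': "q = x # q'" "q' \<in> keys (path_bd d (y # z # r))"
      using keys_cons_chain[of x "path_bd d (y # z # r)"] by blast
    then obtain A a m b B where "y # z # r = A @ a # m # b # B" "q' = A @ a # b # B" "between d a m b"
      using "1.IH" by blast
    then show ?thesis using "1.prems"(1)[of "x # A" a m b B] q' by simp
  qed
qed auto

definition first_face :: "('a \<Rightarrow> 'a \<Rightarrow> real) \<Rightarrow> 'a \<Rightarrow> ('a list \<Rightarrow>\<^sub>0 int) \<Rightarrow> ('a list \<Rightarrow>\<^sub>0 int)" where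
  "first_face d x = frag_extend
     (\<lambda>l. case l of y # z # r \<Rightarrow> if between d x y z then frag_of (x # z # r) else 0 | _ \<Rightarrow> 0)"

lemma first_face_simps [simp]:
  "first_face d x 0 = 0"
  "first_face d x (frag_of (y # z # r)) = (if between d x y z then frag_of (x # z # r) else 0)"
  "first_face d x (frag_of [y]) = 0"
  "first_face d x (a - b) = first_face d x a - first_face d x b"
  "first_face d x (a + b) = first_face d x a + first_face d x b"
  "first_face d x (- a) = - first_face d x a"
  "first_face d x (frag_cmul n a) = frag_cmul n (first_face d x a)"
  by (simp_all add: first_face_def frag_extend_diff frag_extend_add frag_extend_minus
      frag_extend_cmul)

lemma bd_cons_chain: "bd d (cons_chain x c) = - first_face d x c - cons_chain x (bd d c)"
proof -
  have "keys c \<subseteq> UNIV" by simp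
  then show ?thesis
  proof (induction c rule: frag_induction)
    case (one p)
    then show ?case
      by (cases "(d, x # p)" rule: path_bd.cases) (auto simp: first_face_def)
  qed simp_all
qed

lemma first_face_cons_chain:
  assumes "\<And>l. l \<in> keys c \<Longrightarrow> l \<noteq> [] \<and> hd l = z"
  shows "first_face d x (cons_chain y c) = (if between d x y z then cons_chain x c else 0)"
proof -
  have "keys c \<subseteq> {l. l \<noteq> [] \<and> hd l = z}" using assms by blast
  then show ?thesis
  proof (induction c rule: frag_induction)
    case (one p)
    then obtain r where "p = z # r" by (cases p) auto
    then show ?case by simp
  qed simp_all
qed

text \<open>Splits off from the boundary the face that removes \<open>m\<close>. Removing points at different places may
give equal lists, so the remainder \<open>R\<close> is controlled by the position \<open>length A'\<close> of the removed
point, not by the resulting list.\<close>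

lemma path_bd_isolate_face:
  obtains R where "path_bd d (A @ a # m # b # B) = frag_cmul ((-1) ^ Suc (length A))
      (if between d a m b then frag_of (A @ a # b # B) else 0) + R"
    "\<And>\<sigma>. \<sigma> \<in> keys R \<Longrightarrow> \<exists>A' x m' y B'. A @ a # m # b # B = A' @ x # m' # y # B'
        \<and> \<sigma> = A' @ x # y # B' \<and> between d x m' y \<and> length A' \<noteq> length A"
proof (induction A arbitrary: thesis)
  case Nil
  show ?case
  proof (rule Nil[of "- cons_chain a (path_bd d (m # b # B))"])
    fix \<sigma> assume "\<sigma> \<in> keys (- cons_chain a (path_bd d (m # b # B)))"
    then obtain \<tau> where "\<sigma> = a # \<tau>" "\<tau> \<in> keys (path_bd d (m # b # B))"
      using keys_cons_chain[of a "path_bd d (m # b # B)"] by auto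
    then obtain A x m' y B' where "m # b # B = A @ x # m' # y # B'" "\<tau> = A @ x # y # B'"
      "between d x m' y" by (blast elim: path_bd_keysE)
    then show "\<exists>A' x m' y B'. [] @ a # m # b # B = A' @ x # m' # y # B'
        \<and> \<sigma> = A' @ x # y # B' \<and> between d x m' y \<and> length A' \<noteq> length []"
      using \<open>\<sigma> = a # \<tau>\<close> by (intro exI[of _ "a # A"]) auto
  qed simp
next
  case (Cons z A)
  let ?l = "A @ a # m # b # B"
  obtain R where R: "path_bd d ?l = frag_cmul ((-1) ^ Suc (length A))
      (if between d a m b then frag_of (A @ a # b # B) else 0) + R"
    "\<And>\<sigma>. \<sigma> \<in> keys R \<Longrightarrow> \<exists>A' x m' y B'. ?l = A' @ x # m' # y # B'
        \<and> \<sigma> = A' @ x # y # B' \<and> between d x m' y \<and> length A' \<noteq> length A"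
    by (rule Cons.IH) blast
  obtain y w r where l: "?l = y # w # r"
    by (cases A; cases "tl A") auto
  show ?case
  proof (rule Cons.prems[of "- first_face d z (frag_of ?l) - cons_chain z R"])
    have "path_bd d ((z # A) @ a # m # b # B)
        = - first_face d z (frag_of ?l) - cons_chain z (path_bd d ?l)"
      using bd_cons_chain[of d z "frag_of ?l"] by simp
    then show "path_bd d ((z # A) @ a # m # b # B) = frag_cmul ((-1) ^ Suc (length (z # A)))
        (if between d a m b then frag_of ((z # A) @ a # b # B) else 0)
          + (- first_face d z (frag_of ?l) - cons_chain z R)"
      unfolding R(1) by auto
  next
    fix \<sigma> assume "\<sigma> \<in> keys (- first_face d z (frag_of ?l) - cons_chain z R)"
    then consider "\<sigma> \<in> keys (first_face d z (frag_of ?l))" | "\<sigma> \<in> keys (cons_chain z R)"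
      by (auto elim: keys_diffE)
    then show "\<exists>A' x m' y B'. (z # A) @ a # m # b # B = A' @ x # m' # y # B'
        \<and> \<sigma> = A' @ x # y # B' \<and> between d x m' y \<and> length A' \<noteq> length (z # A)"
    proof cases
      case 1
      then show ?thesis unfolding append_Cons l
        by (intro exI[of _ "[]"] exI[of _ z] exI[of _ y] exI[of _ w] exI[of _ r])
          (auto split: if_splits)
    next
      case 2
      then obtain \<tau> where \<tau>: "\<sigma> = z # \<tau>" "\<tau> \<in> keys R"
        using keys_cons_chain[of z R] by auto
      from R(2)[OF \<tau>(2)] obtain A' x m' y B' where "?l = A' @ x # m' # y # B'"
        "\<tau> = A' @ x # y # B'" "between d x m' y" "length A' \<noteq> length A" by blast
      then show ?thesis
        using \<tau>(1) by (intro exI[of _ "z # A'"]) auto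
    qed
  qed
qed

lemma path_bd_hd:
  assumes "l \<in> keys (path_bd d (z # r))"
  shows "l \<noteq> [] \<and> hd l = z"
proof -
  from assms obtain A a m b B where "z # r = A @ a # m # b # B" "l = A @ a # b # B"
    by (rule path_bd_keysE)
  then show ?thesis by (cases A) auto
qed

lemma paths_iff:
  "p \<in> paths X k \<longleftrightarrow> length p = Suc k \<and> set p \<subseteq> X \<and> distinct_adj p"
  by (auto simp: paths_def distinct_adj_conv_nth)

lemma saturated_paths_iff:
  "p \<in> saturated_paths X d k \<longleftrightarrow>
     p \<in> paths X k \<and> successively (\<lambda>a b. strictly_between_set X d a b = {}) p"
  by (auto simp: saturated_paths_def paths_iff successively_conv_nth)

context Metric_space
begin

lemma between_distinct:
  assumes "between d a m b" "a \<noteq> m" "a \<in> M" "m \<in> M" "b \<in> M"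
  shows "a \<noteq> b"
  using assms unfolding between_def
  by (metis add_nonneg_eq_0_iff nonneg zero)

lemma between_eq_iff:
  assumes "between d a m b" "a \<in> M" "m \<in> M" "b \<in> M"
  shows "a = b \<longleftrightarrow> a = m \<and> m = b"
  using between_distinct[OF assms(1) _ assms(2-4)] by auto

lemma face_in_paths:
  assumes "A @ a # m # b # B \<in> paths M k" "between d a m b"
  shows "A @ a # b # B \<in> paths M (k - 1)"
proof -
  have "a \<noteq> b"
    by (rule between_distinct[OF assms(2)])
      (use assms(1) in \<open>auto simp: paths_iff distinct_adj_append_iff\<close>)
  with assms(1) show ?thesis
    by (auto simp: paths_iff distinct_adj_append_iff)
qed

lemma keys_path_bd:
  assumes "p \<in> paths M k"
  shows "keys (path_bd d p) \<subseteq> paths M (k - 1)"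
  using assms face_in_paths by (blast elim: path_bd_keysE)

lemma keys_bd:
  assumes "keys c \<subseteq> paths M k"
  shows "keys (bd d c) \<subseteq> paths M (k - 1)"
proof
  fix q assume "q \<in> keys (bd d c)"
  then obtain p where "p \<in> keys c" "q \<in> keys (path_bd d p)"
    unfolding bd_def by (rule frag_extend_keysE)
  with assms keys_path_bd[of p k] show "q \<in> paths M (k - 1)" by blast
qed

text \<open>Both sides say that \<open>x, y, z, w\<close> are aligned in this order. This is what makes the faces of a path
satisfy the simplicial identities.\<close>

lemma between_assoc:
  assumes "x \<in> M" "y \<in> M" "z \<in> M" "w \<in> M"
  shows "between d x y z \<and> between d x z w \<longleftrightarrow> between d y z w \<and> between d x y w"
  using triangle[of x y z] triangle[of x z w] triangle[of y z w] triangle[of x y w] assms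
  unfolding between_def by linarith

text \<open>Removing the first two inner points can be done in either order, by \<open>between_assoc\<close>. All other faces
commute with removing the first inner point for trivial reasons. This is the inductive step of
\<open>bd_path_bd\<close>.\<close>

lemma bd_first_face:
  assumes "set p \<subseteq> M" "x \<in> M"
  shows "bd d (first_face d x (frag_of p)) = first_face d x (path_bd d p)"
proof -
  consider "length p \<le> 2" | y z w r where "p = y # z # w # r"
    by (metis One_nat_def Suc_1 length_0_conv le_SucI length_Cons list.exhaust
        not_less_eq_eq le0 Suc_le_mono)
  then show ?thesis
  proof cases
    case 1
    then have "length p = 0 \<or> length p = 1 \<or> length p = 2" by linarith
    then show ?thesis
      by (auto simp: numeral_2_eq_2 length_Suc_conv first_face_def)
  next
    case 2
    have ff: "first_face d x (cons_chain y (path_bd d (z # w # r)))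
        = (if between d x y z then cons_chain x (path_bd d (z # w # r)) else 0)"
      by (rule first_face_cons_chain) (rule path_bd_hd)
    have as: "between d x y z \<and> between d x z w \<longleftrightarrow> between d y z w \<and> between d x y w"
      by (rule between_assoc) (use assms 2 in auto)
    show ?thesis
      using as by (cases "between d x y z"; cases "between d x z w"; cases "between d y z w";
        cases "between d x y w") (simp_all add: 2 ff)
  qed
qed

proposition bd_path_bd: "set p \<subseteq> M \<Longrightarrow> bd d (path_bd d p) = 0"
proof (induction p)
  case (Cons x p)
  have "path_bd d (x # p) = bd d (cons_chain x (frag_of p))" by simp
  also have "\<dots> = - first_face d x (frag_of p) - cons_chain x (path_bd d p)"
    by (subst bd_cons_chain) simp
  also have "bd d \<dots> = 0"
    using Cons by (simp add: bd_cons_chain bd_first_face)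
  finally show ?case .
qed simp

lemma bd_bd:
  assumes "keys c \<subseteq> paths M k"
  shows "bd d (bd d c) = 0"
  using assms
proof (induction c rule: frag_induction)
  case (one p)
  then show ?case by (simp add: paths_iff bd_path_bd)
qed simp_all

text \<open>The removed point \<open>m\<close> lies strictly between its former neighbours, which are adjacent in the face.\<close>

lemma face_not_saturated:
  assumes "A @ a # m # b # B \<in> paths M k" "between d a m b"
  shows "A @ a # b # B \<notin> saturated_paths M d j"
proof -
  have "m \<in> strictly_between_set M d a b"
    using assms by (auto simp: strictly_between_set_def paths_iff distinct_adj_append_iff)
  then show ?thesis
    by (auto simp: saturated_paths_iff successively_append_iff)
qed

text \<open>Consequently a class has at most one saturated representative. Below this shows that boundaries of
slices vanish as soon as they are known to be saturated.\<close>

lemma saturated_boundary_eq_0: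
  assumes "keys c \<subseteq> paths M k" "keys (bd d c) \<subseteq> (\<Union>j. saturated_paths M d j)"
  shows "bd d c = 0"
proof -
  have "keys (bd d c) = {}"
  proof (rule equals0I)
    fix q assume q: "q \<in> keys (bd d c)"
    then obtain p where "p \<in> keys c" "q \<in> keys (path_bd d p)"
      unfolding bd_def by (rule frag_extend_keysE)
    then show False
      using q assms face_not_saturated by (blast elim: path_bd_keysE)
  qed
  then show ?thesis by simp
qed

end

section \<open>Diagonality in terms of chains\<close>

context Metric_space
begin

lemma magnitude_cycles_eq:
  "magnitude_cycles M d k = {c. keys c \<subseteq> paths M k \<and> bd d c = 0}"
proof -
  have "magnitude_boundary d k c = bd d c" if "keys c \<subseteq> paths M k" for c
    by (rule magnitude_boundary_eq_bd) (use that in \<open>auto simp: paths_iff\<close>)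
  then show ?thesis by (auto simp: magnitude_cycles_def)
qed

lemma magnitude_boundaries_eq:
  "magnitude_boundaries M d k = bd d ` {b. keys b \<subseteq> paths M (k + 1)}"
proof -
  have "magnitude_boundary d (k + 1) c = bd d c" if "keys c \<subseteq> paths M (k + 1)" for c
    by (rule magnitude_boundary_eq_bd) (use that in \<open>auto simp: paths_iff\<close>)
  then show ?thesis by (auto simp: magnitude_boundaries_def)
qed

text \<open>The saturated cycles form a subgroup, and taking classes is a homomorphism, so the subgroup that
their classes generate consists of these classes alone. Diagonality therefore says that each cycle
differs from a saturated chain by a boundary; this chain is then a cycle automatically.\<close>

proposition diagonal_iff:
  "diagonal M d \<longleftrightarrow>
     (\<forall>k c. keys c \<subseteq> paths M k \<longrightarrow> bd d c = 0 \<longrightarrow>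
        (\<exists>z b. keys z \<subseteq> saturated_paths M d k \<and> keys b \<subseteq> paths M (k + 1) \<and> c = z + bd d b))"
proof -
  have "carrier (magnitude_homology M d k) =
        generate (magnitude_homology M d k)
          (homology_class M d k `
             (magnitude_cycles M d k \<inter> carrier (free_Abelian_group (saturated_paths M d k))))
      \<longleftrightarrow> (\<forall>c. keys c \<subseteq> paths M k \<longrightarrow> bd d c = 0 \<longrightarrow>
        (\<exists>z b. keys z \<subseteq> saturated_paths M d k \<and> keys b \<subseteq> paths M (k + 1) \<and> c = z + bd d b))"
    (is "?L \<longleftrightarrow> ?R") for k
  proof -
    define G where "G = magnitude_cycle_group M d k"
    define B where "B = magnitude_boundaries M d k"
    define Z where "Z = magnitude_cycles M d k"
    define S where "S = Z \<inter> carrier (free_Abelian_group (saturated_paths M d k))"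
    interpret F: comm_group "free_Abelian_group (paths M k)"
      by (rule abelian_free_Abelian_group)
    have Z: "subgroup Z (free_Abelian_group (paths M k))"
      by (rule F.subgroupI) (auto simp: Z_def magnitude_cycles_eq keys_add_subset
          intro!: exI[of _ 0])
    have G_eq: "G = (free_Abelian_group (paths M k))\<lparr>carrier := Z\<rparr>"
      by (simp add: G_def Z_def magnitude_cycle_group_def)
    interpret G: group G
      unfolding G_eq by (rule F.subgroup_imp_group[OF Z])
    interpret G: comm_group G
      by (rule G.group_comm_groupI) (auto simp: G_eq add.commute)
    have G_carrier: "carrier G = Z" by (simp add: G_eq)
    have G_inv: "inv\<^bsub>G\<^esub> c = - c" if "c \<in> Z" for c
      unfolding G_eq using F.m_inv_consistent[OF Z that] that
      by (simp add: Z_def magnitude_cycles_eq)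
    have B_sub: "B \<subseteq> Z"
      using keys_bd[of _ "k + 1"] bd_bd[of _ "k + 1"]
      by (auto simp: B_def Z_def magnitude_cycles_eq magnitude_boundaries_eq)
    have B0: "0 \<in> B"
      unfolding B_def magnitude_boundaries_eq by (rule image_eqI[of _ _ 0]) auto
    have B_add: "a + b \<in> B" and B_minus: "- a \<in> B" if "a \<in> B" "b \<in> B" for a b
    proof -
      from that obtain a' b' where *: "a = bd d a'" "b = bd d b'"
        "keys a' \<subseteq> paths M (k + 1)" "keys b' \<subseteq> paths M (k + 1)"
        by (auto simp: B_def magnitude_boundaries_eq)
      show "a + b \<in> B"
        unfolding B_def magnitude_boundaries_eq
        by (rule image_eqI[of _ _ "a' + b'"]) (use * in \<open>auto simp: keys_add_subset\<close>)
      show "- a \<in> B"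
        unfolding B_def magnitude_boundaries_eq
        by (rule image_eqI[of _ _ "- a'"]) (use * in auto)
    qed
    have B: "subgroup B G"
      by (rule G.subgroupI) (use B_sub B0 in \<open>auto simp: G_carrier G_inv B_minus subsetD\<close>,
          simp add: G_eq B_add)
    interpret B: normal B G
      by (rule G.subgroup_imp_normal[OF B])
    interpret Q: group "G Mod B" by (rule B.factorgroup_is_group)
    let ?cl = "\<lambda>c. B #>\<^bsub>G\<^esub> c"
    interpret cl: group_hom G "G Mod B" ?cl
      by (intro group_hom.intro group_hom_axioms.intro G.group_axioms Q.group_axioms
          B.r_coset_hom_Mod)
    have S: "subgroup S G"
    proof (rule G.subgroupI)
      have "0 \<in> S" by (simp add: S_def Z_def magnitude_cycles_eq)
      then show "S \<noteq> {}" by blast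
      show "S \<subseteq> carrier G" by (simp add: S_def G_carrier)
      show "inv\<^bsub>G\<^esub> a \<in> S" if "a \<in> S" for a
        using that by (simp add: S_def G_inv) (simp add: Z_def magnitude_cycles_eq)
      show "a \<otimes>\<^bsub>G\<^esub> b \<in> S" if "a \<in> S" "b \<in> S" for a b
        using that by (simp add: S_def G_eq Z_def magnitude_cycles_eq keys_add_subset)
    qed
    have gen: "generate (G Mod B) (?cl ` S) = ?cl ` S"
    proof -
      have "generate G S = S"
        by (rule G.generateI[symmetric]) (use S in auto)
      then show ?thesis
        using cl.generate_img[of S] S by (simp add: subgroup.subset)
    qed
    have cl_eq: "?cl c = ?cl z \<longleftrightarrow> c - z \<in> B" if "c \<in> Z" "z \<in> Z" for c z
    proof -
      have cl: "?cl x = (\<lambda>b. b + x) ` B" for x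
        by (auto simp: r_coset_def G_eq)
      show ?thesis
      proof
        assume "?cl c = ?cl z"
        moreover have "c \<in> ?cl c" unfolding cl by (rule image_eqI[of _ _ 0]) (use B0 in auto)
        ultimately show "c - z \<in> B" unfolding cl by auto
      next
        assume *: "c - z \<in> B"
        have "(\<lambda>b. b + c) ` B = (\<lambda>b. b + z) ` B"
        proof (rule equalityI; rule subsetI)
          fix x assume "x \<in> (\<lambda>b. b + c) ` B"
          then obtain b where b: "b \<in> B" "x = b + c" by auto
          show "x \<in> (\<lambda>b. b + z) ` B"
            by (rule image_eqI[of _ _ "b + (c - z)"]) (use b * B_add in auto)
        next
          fix x assume "x \<in> (\<lambda>b. b + z) ` B"
          then obtain b where b: "b \<in> B" "x = b + z" by auto
          show "x \<in> (\<lambda>b. b + c) ` B"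
            by (rule image_eqI[of _ _ "b + - (c - z)"]) (use b B_add[OF b(1) B_minus[OF * *]] in \<open>auto simp: algebra_simps\<close>)
        qed
        then show "?cl c = ?cl z" unfolding cl .
      qed
    qed
    have Mod_carrier: "carrier (G Mod B) = ?cl ` Z"
      by (auto simp: FactGroup_def RCOSETS_def G_carrier)
    have "?L \<longleftrightarrow> ?cl ` Z = ?cl ` S"
      unfolding magnitude_homology_def homology_class_def G_def[symmetric] B_def[symmetric]
        Z_def[symmetric] S_def[symmetric] gen Mod_carrier ..
    also have "\<dots> \<longleftrightarrow> (\<forall>c\<in>Z. \<exists>z\<in>S. ?cl c = ?cl z)"
    proof
      assume eq: "?cl ` Z = ?cl ` S"
      show "\<forall>c\<in>Z. \<exists>z\<in>S. ?cl c = ?cl z"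
      proof
        fix c assume "c \<in> Z"
        then have "?cl c \<in> ?cl ` S" unfolding eq[symmetric] by (rule imageI)
        then show "\<exists>z\<in>S. ?cl c = ?cl z" by (simp add: image_iff)
      qed
    next
      assume *: "\<forall>c\<in>Z. \<exists>z\<in>S. ?cl c = ?cl z"
      have "S \<subseteq> Z" by (simp add: S_def)
      with * show "?cl ` Z = ?cl ` S" by (force simp: image_iff)
    qed
    also have "\<dots> \<longleftrightarrow> (\<forall>c\<in>Z. \<exists>z\<in>S. c - z \<in> B)"
      using cl_eq by (simp add: S_def Bex_def cong: conj_cong)
    also have "\<dots> \<longleftrightarrow> ?R"
    proof
      assume L: "\<forall>c\<in>Z. \<exists>z\<in>S. c - z \<in> B"
      show ?R
      proof (intro allI impI)
        fix c assume "keys c \<subseteq> paths M k" "bd d c = 0"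
        then obtain z where z: "z \<in> S" "c - z \<in> B"
          using L by (auto simp: Z_def magnitude_cycles_eq)
        then obtain b where "keys b \<subseteq> paths M (k + 1)" "c - z = bd d b"
          by (auto simp: B_def magnitude_boundaries_eq)
        then show "\<exists>z b. keys z \<subseteq> saturated_paths M d k \<and> keys b \<subseteq> paths M (k + 1)
            \<and> c = z + bd d b"
          using z by (intro exI[of _ z] exI[of _ b]) (auto simp: S_def algebra_simps)
      qed
    next
      assume R: ?R
      show "\<forall>c\<in>Z. \<exists>z\<in>S. c - z \<in> B"
      proof
        fix c assume "c \<in> Z"
        then have c: "keys c \<subseteq> paths M k" "bd d c = 0"
          by (auto simp: Z_def magnitude_cycles_eq)
        with R obtain z b where zb: "keys z \<subseteq> saturated_paths M d k" "keys b \<subseteq> paths M (k + 1)"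
          "c = z + bd d b" by blast
        have "bd d z = 0" using c zb bd_bd[of b "k + 1"] by simp
        then have "z \<in> S" using zb
          by (auto simp: S_def Z_def magnitude_cycles_eq saturated_paths_def)
        moreover have "c - z \<in> B" using zb by (auto simp: B_def magnitude_boundaries_eq)
        ultimately show "\<exists>z\<in>S. c - z \<in> B" by blast
      qed
    qed
    finally show ?thesis .
  qed
  then show ?thesis by (simp add: diagonal_def)
qed

lemma diagonalE:
  assumes "diagonal M d" "keys c \<subseteq> paths M k" "bd d c = 0"
  obtains z b where "keys z \<subseteq> saturated_paths M d k" "keys b \<subseteq> paths M (k + 1)" "c = z + bd d b"
  using assms(1)[unfolded diagonal_iff, rule_format, OF assms(2,3)] that by auto

end

section \<open>Shuffle products\<close>

text \<open>The tensor product of free groups, as the free group on pairs of generators.\<close>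

definition tensor :: "('a \<Rightarrow>\<^sub>0 int) \<Rightarrow> ('b \<Rightarrow>\<^sub>0 int) \<Rightarrow> ('a \<times> 'b \<Rightarrow>\<^sub>0 int)" where
  "tensor u v = frag_extend (\<lambda>p. frag_extend (\<lambda>q. frag_of (p, q)) v) u"

lemma lookup_tensor: "lookup (tensor u v) (p, q) = lookup u p * lookup v q"
proof -
  have inner: "lookup (frag_extend (\<lambda>q. frag_of (p', q)) v) (p, q)
      = (if p' = p then lookup v q else 0)" for p'
    by (simp add: lookup_frag_extend in_keys_iff if_distrib[of "\<lambda>n. _ * n"] eq_commute[of q]
        cong: if_cong)
  show ?thesis
    by (simp add: tensor_def lookup_frag_extend[of _ u] inner in_keys_iff
        if_distrib[of "\<lambda>n. _ * n"] cong: if_cong)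
qed

lemma tensor_simps [simp]:
  "tensor (frag_of p) (frag_of q) = frag_of (p, q)"
  "tensor 0 v = 0" "tensor u 0 = 0"
  "tensor (a - b) v = tensor a v - tensor b v" "tensor u (a - b) = tensor u a - tensor u b"
  "tensor (a + b) v = tensor a v + tensor b v" "tensor u (a + b) = tensor u a + tensor u b"
  "tensor (- a) v = - tensor a v" "tensor u (- a) = - tensor u a"
  "tensor (frag_cmul n a) v = frag_cmul n (tensor a v)"
  "tensor u (frag_cmul n a) = frag_cmul n (tensor u a)"
  by (rule poly_mapping_eqI,
      auto simp: lookup_tensor lookup_minus lookup_add algebra_simps split: if_splits)+


lemma keys_tensor: "keys (tensor u v) \<subseteq> keys u \<times> keys v"
  by (auto simp: lookup_tensor in_keys_iff)

text \<open>The first step of a shuffle is either the first step of \<open>p\<close> or the first step of \<open>q\<close>; in the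
second case it moves past the \<open>length p\<close> steps of \<open>x # p\<close>, which accounts for the sign. The empty
list has no shuffles, so that the recursion also covers the case that one path has no steps left.\<close>

fun shuffle :: "'a list \<Rightarrow> 'b list \<Rightarrow> (('a \<times> 'b) list \<Rightarrow>\<^sub>0 int)" where
  "shuffle (x # p) (y # q) =
     (if p = [] \<and> q = [] then frag_of [(x, y)]
      else cons_chain (x, y)
        (shuffle p (y # q) + frag_cmul ((-1) ^ length p) (shuffle (x # p) q)))"
| "shuffle [] _ = 0"
| "shuffle _ [] = 0"

definition shuffles :: "('a list \<times> 'b list \<Rightarrow>\<^sub>0 int) \<Rightarrow> (('a \<times> 'b) list \<Rightarrow>\<^sub>0 int)" where
  "shuffles = frag_extend (\<lambda>(p, q). shuffle p q)"

lemma shuffles_simps [simp]: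
  "shuffles 0 = 0"
  "shuffles (frag_of (p, q)) = shuffle p q"
  "shuffles (a - b) = shuffles a - shuffles b"
  "shuffles (a + b) = shuffles a + shuffles b"
  "shuffles (- a) = - shuffles a"
  "shuffles (frag_cmul n a) = frag_cmul n (shuffles a)"
  by (simp_all add: shuffles_def frag_extend_diff frag_extend_add frag_extend_minus
      frag_extend_cmul)

declare shuffle.simps(1) [simp del]

lemma shuffle_singletons [simp]: "shuffle [x] [y] = frag_of [(x, y)]"
  by (simp add: shuffle.simps)

lemma shuffle_Nil2 [simp]: "shuffle p [] = 0"
  by (cases p) auto

lemma shuffle_Cons_Cons:
  assumes "p \<noteq> [] \<or> q \<noteq> []"
  shows "shuffle (x # p) (y # q) = cons_chain (x, y)
    (shuffle p (y # q) + frag_cmul ((-1) ^ length p) (shuffle (x # p) q))"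
  using assms by (simp only: shuffle.simps) auto

lemma shuffle_keysE:
  assumes "l \<in> keys (shuffle (x # p) (y # q))"
  obtains "p = []" "q = []" "l = [(x, y)]"
  | l' where "l = (x, y) # l'" "l' \<in> keys (shuffle p (y # q))"
  | l' where "l = (x, y) # l'" "l' \<in> keys (shuffle (x # p) q)"
proof (cases "p = [] \<and> q = []")
  case False
  then have "l \<in> keys (cons_chain (x, y)
        (shuffle p (y # q) + frag_cmul ((-1) ^ length p) (shuffle (x # p) q)))"
    using assms shuffle_Cons_Cons[of p q x y] by metis
  then obtain l' where "l = (x, y) # l'"
    "l' \<in> keys (shuffle p (y # q) + frag_cmul ((-1) ^ length p) (shuffle (x # p) q))"
    using keys_cons_chain[of "(x, y)"] by blast
  then show ?thesis using that(2,3) by (auto elim!: keys_addE)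
qed (use assms that(1) in auto)

lemma shuffle_hd:
  assumes "l \<in> keys (shuffle (x # p) (y # q))"
  shows "l \<noteq> [] \<and> hd l = (x, y)"
  using assms by (rule shuffle_keysE) auto

lemma shuffles_tensor_Nil [simp]: "shuffles (tensor (frag_of []) v) = 0"
proof -
  have "keys v \<subseteq> UNIV" by simp
  then show ?thesis by (induction v rule: frag_induction) simp_all
qed

lemma shuffles_tensor_Nil2 [simp]: "shuffles (tensor u (frag_of [])) = 0"
proof -
  have "keys u \<subseteq> UNIV" by simp
  then show ?thesis by (induction u rule: frag_induction) simp_all
qed

text \<open>The defining recursion of the shuffle product, extended linearly in one argument. Chains of constant
length are needed on the left because the sign depends on it.\<close>

lemma shuffles_cons_left:
  assumes "\<And>p. p \<in> keys u \<Longrightarrow> p \<noteq> [] \<and> length p = n"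
  shows "shuffles (tensor (cons_chain x u) (frag_of (y # q))) = cons_chain (x, y)
    (shuffles (tensor u (frag_of (y # q)))
      + frag_cmul ((-1) ^ n) (shuffles (tensor (cons_chain x u) (frag_of q))))"
proof -
  have "keys u \<subseteq> {p. p \<noteq> [] \<and> length p = n}" using assms by blast
  then show ?thesis
    by (induction u rule: frag_induction)
      (auto simp: shuffle_Cons_Cons frag_cmul_diff_distrib2 simp del: minus_frag_cmul)
qed

lemma shuffles_cons_right:
  assumes "\<And>q. q \<in> keys v \<Longrightarrow> q \<noteq> []"
  shows "shuffles (tensor (frag_of (x # p)) (cons_chain y v)) = cons_chain (x, y)
    (shuffles (tensor (frag_of p) (cons_chain y v))
      + frag_cmul ((-1) ^ length p) (shuffles (tensor (frag_of (x # p)) v)))"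
proof -
  have "keys v \<subseteq> {q. q \<noteq> []}" using assms by blast
  then show ?thesis
    by (induction v rule: frag_induction)
      (auto simp: shuffle_Cons_Cons frag_cmul_diff_distrib2 simp del: minus_frag_cmul)
qed

text \<open>The first face of \<open>x # p\<close> without its leading point \<open>x\<close>. Thus the whole boundary of
\<open>x # p\<close> starts at \<open>x\<close>, and \<open>path_bd_Cons\<close> exhibits its tail, to which the recursion of the
shuffle product applies.\<close>

definition second :: "('a \<Rightarrow> 'a \<Rightarrow> real) \<Rightarrow> 'a \<Rightarrow> 'a list \<Rightarrow> ('a list \<Rightarrow>\<^sub>0 int)" where
  "second d x p = (case p of y # z # r \<Rightarrow> if between d x y z then frag_of (z # r) else 0 | _ \<Rightarrow> 0)"

lemma second_simps [simp]:
  "second d x [] = 0" "second d x [y] = 0"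
  "second d x (y # z # r) = (if between d x y z then frag_of (z # r) else 0)"
  by (simp_all add: second_def)

lemma path_bd_Cons: "path_bd d (x # p) = - cons_chain x (second d x p + path_bd d p)"
  by (cases "(d, x # p)" rule: path_bd.cases) auto

lemma second_keys: "l \<in> keys (second d x p) \<Longrightarrow> l \<noteq> [] \<and> length l = length p - 1"
  by (cases "(d, x # p)" rule: path_bd.cases) (auto split: if_splits)

lemma path_bd_keys: "l \<in> keys (path_bd d p) \<Longrightarrow> l \<noteq> [] \<and> length l = length p - 1"
  by (auto elim!: path_bd_keysE)

lemma l1_between [simp]:
  "between (l1_dist dX dY) (x, y) (x', y') (x'', y'') \<longleftrightarrow>
    dX x x'' + dY y y'' = dX x x' + dY y y' + (dX x' x'' + dY y' y'')"
  by (simp add: between_def l1_dist_def)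

locale metric_pair = MX: Metric_space X dX + MY: Metric_space Y dY
  for X :: "'a set" and dX and Y :: "'b set" and dY
begin

abbreviation dXY where "dXY \<equiv> l1_dist dX dY"

sublocale MXY: Metric_space "X \<times> Y" dXY
  by (rule Metric_space_l1_dist) (rule MX.Metric_space_axioms MY.Metric_space_axioms)+

text \<open>The point removed is the end of a horizontal step. If a horizontal step follows, a face of \<open>p\<close>
results. If a vertical step follows, the removed corner is always between its neighbours, and a
diagonal step results; this contributes the last summand, which will cancel against the one in
\<open>first_face_shuffle_right\<close>.\<close>

lemma first_face_shuffle_left:
  assumes "x \<in> X" "set p \<subseteq> X" "set (y # q) \<subseteq> Y"
  shows "first_face dXY (x, y) (shuffle p (y # q)) = cons_chain (x, y)
    (shuffles (tensor (second dX x p) (frag_of (y # q)))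
      + frag_cmul ((-1) ^ (length p - 1)) (shuffle p q))"
proof (cases p)
  case (Cons x' r)
  note p = this
  show ?thesis
  proof (cases "r = [] \<and> q = []")
    case False
    have 1: "first_face dXY (x, y) (cons_chain (x', y) (shuffle r (y # q)))
        = cons_chain (x, y) (shuffles (tensor (second dX x p) (frag_of (y # q))))"
    proof (cases r)
      case (Cons x'' r')
      have "first_face dXY (x, y) (cons_chain (x', y) (shuffle r (y # q))) =
         (if between dXY (x, y) (x', y) (x'', y) then cons_chain (x, y) (shuffle r (y # q)) else 0)"
        unfolding Cons by (rule first_face_cons_chain) (rule shuffle_hd)
      then show ?thesis
        using assms by (simp add: p Cons) (simp add: between_def)
    qed (simp add: p)
    have 2: "first_face dXY (x, y) (cons_chain (x', y) (shuffle p q))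
        = cons_chain (x, y) (shuffle p q)"
    proof (cases q)
      case (Cons y' q')
      have "first_face dXY (x, y) (cons_chain (x', y) (shuffle p q)) =
         (if between dXY (x, y) (x', y) (x', y') then cons_chain (x, y) (shuffle p q) else 0)"
        unfolding Cons p by (rule first_face_cons_chain) (rule shuffle_hd)
      then show ?thesis
        using assms by (simp add: p Cons)
    qed simp
    have "shuffle p (y # q) = cons_chain (x', y)
        (shuffle r (y # q) + frag_cmul ((-1) ^ length r) (shuffle p q))"
      unfolding p by (rule shuffle_Cons_Cons) (use False in blast)
    then show ?thesis
      using 1 2 by (simp add: p)
  qed (simp add: p)
qed simp

lemma first_face_shuffle_right:
  assumes "set (x # p) \<subseteq> X" "y \<in> Y" "set q \<subseteq> Y"
  shows "first_face dXY (x, y) (shuffle (x # p) q) = cons_chain (x, y)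
    (frag_cmul ((-1) ^ length p) (shuffles (tensor (frag_of (x # p)) (second dY y q)))
      + shuffle p q)"
proof (cases q)
  case (Cons y' r)
  note q = this
  show ?thesis
  proof (cases "p = [] \<and> r = []")
    case False
    have 1: "first_face dXY (x, y) (cons_chain (x, y') (shuffle (x # p) r))
        = cons_chain (x, y) (shuffles (tensor (frag_of (x # p)) (second dY y q)))"
    proof (cases r)
      case (Cons y'' r')
      have "first_face dXY (x, y) (cons_chain (x, y') (shuffle (x # p) r)) =
         (if between dXY (x, y) (x, y') (x, y'') then cons_chain (x, y) (shuffle (x # p) r) else 0)"
        unfolding Cons by (rule first_face_cons_chain) (rule shuffle_hd)
      then show ?thesis
        using assms by (simp add: q Cons) (simp add: between_def)
    qed (simp add: q)
    have 2: "first_face dXY (x, y) (cons_chain (x, y') (shuffle p q))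
        = cons_chain (x, y) (shuffle p q)"
    proof (cases p)
      case (Cons x' p')
      have "first_face dXY (x, y) (cons_chain (x, y') (shuffle p q)) =
         (if between dXY (x, y) (x, y') (x', y') then cons_chain (x, y) (shuffle p q) else 0)"
        unfolding Cons q by (rule first_face_cons_chain) (rule shuffle_hd)
      then show ?thesis
        using assms by (simp add: q Cons)
    qed simp
    have "shuffle (x # p) q = cons_chain (x, y')
        (shuffle p q + frag_cmul ((-1) ^ length p) (shuffle (x # p) r))"
      unfolding q by (rule shuffle_Cons_Cons) (use False in blast)
    then show ?thesis
      using 1 2 by (simp add: add.commute)
  qed (simp add: q)
qed simp

text \<open>The shuffle product is a chain map. The proof is a bookkeeping of the first face and of the later
faces: the first faces that cut a corner cancel in pairs, the others, together with the faces of the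
shorter shuffles given by induction, are the shuffles of the faces of \<open>p\<close> and of \<open>q\<close>.\<close>

proposition bd_shuffle:
  assumes "set p \<subseteq> X" "set q \<subseteq> Y"
  shows "bd dXY (shuffle p q) = shuffles (tensor (path_bd dX p) (frag_of q))
    + frag_cmul ((-1) ^ (length p - 1)) (shuffles (tensor (frag_of p) (path_bd dY q)))"
  using assms
proof (induction p q rule: shuffle.induct)
  case (1 x p y q)
  show ?case
  proof (cases "p = [] \<and> q = []")
    case False
    define n where "n = length p"
    define s :: int where "s = (-1) ^ n"
    define s' :: int where "s' = (-1) ^ (n - 1)"
    have ss: "s * s = 1" by (simp add: s_def flip: power_add mult_2)
    have s': "n = 0 \<or> s' = - s"
      by (cases n) (auto simp: s_def s'_def)
    let ?cons = "cons_chain (x, y)" and ?S = "\<lambda>u v. shuffles (tensor u v)"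
      and ?p = "frag_of p" and ?xp = "frag_of (x # p)" and ?q = "frag_of q" and ?yq = "frag_of (y # q)"
    define A where "A = ?cons (?S (second dX x p) ?yq)"
    define B where "B = ?cons (?S (path_bd dX p) ?yq)"
    define C where "C = ?cons (?S (path_bd dX (x # p)) ?q)"
    define D where "D = ?cons (?S ?p (path_bd dY (y # q)))"
    define E where "E = ?cons (?S ?xp (second dY y q))"
    define F where "F = ?cons (?S ?xp (path_bd dY q))"
    define H where "H = ?cons (shuffle p q)"
    have n0: "D = 0" "C = 0" "H = 0" if "n = 0"
      using that by (simp_all add: n_def D_def C_def H_def)
    \<comment> \<open>For \<open>n = 0\<close> truncated subtraction gives \<open>s' = s\<close>, but then the chains concerned are \<open>0\<close>.\<close>
    have sCDH: "frag_cmul s' C = - frag_cmul s C" "frag_cmul s' D = - frag_cmul s D"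
      "frag_cmul s' H = - frag_cmul s H"
      using s' n0 by auto
    have X: "?S (path_bd dX (x # p)) ?yq = - A - B + frag_cmul s' C"
    proof -
      have "?S (cons_chain x (second dX x p + path_bd dX p)) ?yq = ?cons
        (?S (second dX x p + path_bd dX p) ?yq
          + frag_cmul s' (?S (cons_chain x (second dX x p + path_bd dX p)) ?q))"
        unfolding s'_def n_def
        by (rule shuffles_cons_left) (metis keys_addE second_keys path_bd_keys)
      then show ?thesis
        unfolding path_bd_Cons[of dX x p] A_def B_def C_def
        by (simp add: algebra_simps frag_cmul_distrib2 frag_cmul_diff_distrib2
            frag_cmul_minus2 del: minus_frag_cmul)
    qed
    have Y: "?S ?xp (path_bd dY (y # q)) = D - frag_cmul s E - frag_cmul s F"
    proof -
      have "?S ?xp (cons_chain y (second dY y q + path_bd dY q)) = ?cons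
        (?S ?p (cons_chain y (second dY y q + path_bd dY q))
          + frag_cmul s (?S ?xp (second dY y q + path_bd dY q)))"
        unfolding s_def n_def
        by (rule shuffles_cons_right) (metis keys_addE second_keys path_bd_keys)
      then show ?thesis
        unfolding path_bd_Cons[of dY y q] D_def E_def F_def
        by (simp add: algebra_simps frag_cmul_distrib2 frag_cmul_diff_distrib2
            frag_cmul_minus2 del: minus_frag_cmul)
    qed
    have "shuffle (x # p) (y # q) = ?cons (shuffle p (y # q) + frag_cmul s (shuffle (x # p) q))"
      unfolding s_def n_def by (rule shuffle_Cons_Cons) (use False in blast)
    then have "bd dXY (shuffle (x # p) (y # q))
        = - first_face dXY (x, y) (shuffle p (y # q))
          - frag_cmul s (first_face dXY (x, y) (shuffle (x # p) q))
          - ?cons (bd dXY (shuffle p (y # q)))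
          - frag_cmul s (?cons (bd dXY (shuffle (x # p) q)))"
      by (simp add: bd_cons_chain algebra_simps frag_cmul_distrib2 frag_cmul_diff_distrib2
            frag_cmul_minus2 del: minus_frag_cmul)
    also have "first_face dXY (x, y) (shuffle p (y # q)) = A + frag_cmul s' H"
      using first_face_shuffle_left[of x p y q] "1.prems"
      by (simp add: A_def H_def s'_def n_def)
    also have "first_face dXY (x, y) (shuffle (x # p) q) = frag_cmul s E + H"
      using first_face_shuffle_right[of x p y q] "1.prems"
      by (simp add: E_def H_def s_def n_def)
    also have "?cons (bd dXY (shuffle p (y # q))) = B + frag_cmul s' D"
      using 1 False by (simp add: B_def D_def s'_def n_def)
    also have "?cons (bd dXY (shuffle (x # p) q)) = C + frag_cmul s F"
      using 1 False by (simp add: C_def F_def s_def n_def)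
    finally have *: "bd dXY (shuffle (x # p) (y # q))
        = - (A + frag_cmul s' H) - frag_cmul s (frag_cmul s E + H)
          - (B + frag_cmul s' D) - frag_cmul s (C + frag_cmul s F)" .
    have "\<dots> = (- A - B + frag_cmul s' C) + frag_cmul s (D - frag_cmul s E - frag_cmul s F)"
      by (simp add: sCDH frag_cmul_distrib2 frag_cmul_diff_distrib2 frag_cmul_minus2 ss
            algebra_simps del: minus_frag_cmul)
    then show ?thesis
      unfolding * using X Y by (simp add: s_def n_def)
  qed simp
qed simp_all

definition tensor_bd :: "('a list \<times> 'b list \<Rightarrow>\<^sub>0 int) \<Rightarrow> ('a list \<times> 'b list \<Rightarrow>\<^sub>0 int)" where
  "tensor_bd = frag_extend (\<lambda>(p, q). tensor (path_bd dX p) (frag_of q)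
     + frag_cmul ((-1) ^ (length p - 1)) (tensor (frag_of p) (path_bd dY q)))"

lemma tensor_bd_simps [simp]:
  "tensor_bd 0 = 0"
  "tensor_bd (a - b) = tensor_bd a - tensor_bd b"
  "tensor_bd (a + b) = tensor_bd a + tensor_bd b"
  "tensor_bd (frag_of (p, q)) = tensor (path_bd dX p) (frag_of q)
     + frag_cmul ((-1) ^ (length p - 1)) (tensor (frag_of p) (path_bd dY q))"
  by (simp_all add: tensor_bd_def frag_extend_diff frag_extend_add)

lemma tensor_bd_cmul: "tensor_bd (frag_cmul n t) = frag_cmul n (tensor_bd t)"
  by (simp add: tensor_bd_def frag_extend_cmul)

lemma tensor_bd_sum: "finite I \<Longrightarrow> tensor_bd (sum f I) = (\<Sum>i\<in>I. tensor_bd (f i))"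
  by (induction I rule: finite_induct) simp_all

text \<open>The generators of degree \<open>k\<close> of the tensor product of the two magnitude complexes.\<close>

definition product_paths :: "nat \<Rightarrow> ('a list \<times> 'b list) set" where
  "product_paths k = (\<Union>i\<le>k. paths X i \<times> paths Y (k - i))"

lemma product_pathsE:
  assumes "(p, q) \<in> product_paths k"
  obtains i j where "i + j = k" "p \<in> paths X i" "q \<in> paths Y j"
proof -
  from assms obtain i where "i \<le> k" "p \<in> paths X i" "q \<in> paths Y (k - i)"
    by (auto simp: product_paths_def)
  with that[of i "k - i"] show ?thesis by simp
qed

lemma product_pathsI:
  assumes "i + j = k" "p \<in> paths X i" "q \<in> paths Y j"
  shows "(p, q) \<in> product_paths k"
  using assms by (auto simp: product_paths_def)

lemma bd_shuffles:
  assumes "keys t \<subseteq> product_paths k"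
  shows "bd dXY (shuffles t) = shuffles (tensor_bd t)"
  using assms
proof (induction t rule: frag_induction)
  case (one pq)
  obtain p q where pq: "pq = (p, q)" by fastforce
  with one show ?case by (auto elim!: product_pathsE simp: paths_iff bd_shuffle)
qed simp_all

lemma tensor_bd_tensor:
  assumes "keys u \<subseteq> paths X i"
  shows "tensor_bd (tensor u v) = tensor (bd dX u) v + frag_cmul ((-1) ^ i) (tensor u (bd dY v))"
  using assms
proof (induction u rule: frag_induction)
  case (one p)
  then have i: "length p - Suc 0 = i" by (simp add: paths_iff)
  have "keys v \<subseteq> UNIV" by simp
  then show ?case
    by (induction v rule: frag_induction)
      (simp_all add: i frag_cmul_diff_distrib2 algebra_simps del: minus_frag_cmul)
qed (simp_all add: frag_cmul_diff_distrib2 algebra_simps del: minus_frag_cmul)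

end

section \<open>Words of steps\<close>

datatype direction = Horiz | Vert | Diag

fun step :: "'a \<times> 'b \<Rightarrow> 'a \<times> 'b \<Rightarrow> direction" where
  "step (x, y) (x', y') = (if x = x' then Vert else if y = y' then Horiz else Diag)"

fun word :: "('a \<times> 'b) list \<Rightarrow> direction list" where
  "word (a # b # l) = step a b # word (b # l)"
| "word _ = []"

lemma step_eq_iff:
  "step u v = Vert \<longleftrightarrow> fst u = fst v"
  "step u v = Horiz \<longleftrightarrow> fst u \<noteq> fst v \<and> snd u = snd v"
  "step u v = Diag \<longleftrightarrow> fst u \<noteq> fst v \<and> snd u \<noteq> snd v"
  by (cases u; cases v; simp)+

text \<open>The direction of the step that results from two consecutive steps when the point between them is
removed in a face; see \<open>step_merge\<close>.\<close>

definition merge :: "direction \<Rightarrow> direction \<Rightarrow> direction" where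
  "merge s t = (if s = t then s else Diag)"

lemma word_append: "word (A @ a # B) = word (A @ [a]) @ word (a # B)"
proof (induction A)
  case (Cons x A)
  then show ?case by (cases A) auto
qed simp

lemma word_Cons: "l \<noteq> [] \<Longrightarrow> word (a # l) = step a (hd l) # word l"
  by (cases l) auto

lemma length_word [simp]: "length (word l) = length l - 1"
  by (induction l rule: word.induct) auto

lemma word_split:
  assumes "word l = V @ s # W"
  obtains A u v B where "l = A @ u # v # B" "word (A @ [u]) = V" "step u v = s" "word (v # B) = W"
    "length A = length V"
  using assms
proof (induction V arbitrary: l thesis)
  case Nil
  then obtain u v B where "l = u # v # B" "step u v = s" "word (v # B) = W"
    by (cases l rule: word.cases) auto
  then show ?case using Nil(1)[of "[]" u v B] by simp
next
  case (Cons t V)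
  then obtain x y l' where l: "l = x # y # l'" "step x y = t" "word (y # l') = V @ s # W"
    by (cases l rule: word.cases) auto
  with Cons.IH obtain A u v B where *: "y # l' = A @ u # v # B" "word (A @ [u]) = V"
    "step u v = s" "word (v # B) = W" "length A = length V"
    by metis
  have "A @ [u] \<noteq> []" "hd (A @ [u]) = y"
    using *(1) by (cases A; simp)+
  then have "word ((x # A) @ [u]) = t # V"
    using * l word_Cons[of "A @ [u]" x] by simp
  then show ?case using Cons.prems(1)[of "x # A" u v B] l * by simp
qed

text \<open>Reading a word from the left, the first letter that spoils the shape ``horizontal, then vertical''
is either diagonal (lower words) or horizontal (upper words). The numbers \<open>a\<close> and \<open>b\<close> locate it.
They are chosen so that replacing this diagonal letter by a vertical and a horizontal one takes
lower words to upper words with the same \<open>a\<close> and \<open>b\<close>.\<close>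

definition normal_word :: "direction list \<Rightarrow> bool" where
  "normal_word w \<longleftrightarrow> (\<exists>a b. w = replicate a Horiz @ replicate b Vert)"

definition lower_word :: "nat \<Rightarrow> nat \<Rightarrow> direction list \<Rightarrow> bool" where
  "lower_word a b w \<longleftrightarrow> (\<exists>w'. w = replicate a Horiz @ replicate b Vert @ Diag # w')"

definition upper_word :: "nat \<Rightarrow> nat \<Rightarrow> direction list \<Rightarrow> bool" where
  "upper_word a b w \<longleftrightarrow> (\<exists>w'. w = replicate a Horiz @ replicate (Suc b) Vert @ Horiz # w')"

lemma lower_word_simps [simp]:
  "\<not> lower_word a b []"
  "lower_word a b (Horiz # w) \<longleftrightarrow> (\<exists>a'. a = Suc a' \<and> lower_word a' b w)"
  "lower_word a b (Vert # w) \<longleftrightarrow> a = 0 \<and> (\<exists>b'. b = Suc b' \<and> lower_word 0 b' w)"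
  "lower_word a b (Diag # w) \<longleftrightarrow> a = 0 \<and> b = 0"
  by (cases a; cases b; simp add: lower_word_def)+

lemma upper_word_simps [simp]:
  "\<not> upper_word a b []"
  "upper_word a b (Horiz # w) \<longleftrightarrow> (\<exists>a'. a = Suc a' \<and> upper_word a' b w)"
  "upper_word a b (Vert # w) \<longleftrightarrow>
     a = 0 \<and> (b = 0 \<and> (\<exists>w'. w = Horiz # w') \<or> (\<exists>b'. b = Suc b' \<and> upper_word 0 b' w))"
  "\<not> upper_word a b (Diag # w)"
  by (cases a; cases b; auto simp: upper_word_def)+

lemma normal_word_Horiz [simp]: "normal_word (Horiz # w) \<longleftrightarrow> normal_word w"
proof
  assume "normal_word (Horiz # w)"
  then obtain a b where *: "Horiz # w = replicate a Horiz @ replicate b Vert"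
    by (auto simp: normal_word_def)
  then obtain a' where "a = Suc a'"
    by (cases a; cases b) auto
  with * have "w = replicate a' Horiz @ replicate b Vert" by simp
  then show "normal_word w" unfolding normal_word_def by blast
next
  assume "normal_word w"
  then obtain a b where "w = replicate a Horiz @ replicate b Vert" by (auto simp: normal_word_def)
  then have "Horiz # w = replicate (Suc a) Horiz @ replicate b Vert" by simp
  then show "normal_word (Horiz # w)" unfolding normal_word_def by blast
qed

lemma normal_word_Vert: "normal_word (Vert # w) \<longleftrightarrow> (\<exists>b. w = replicate b Vert)"
proof
  assume "normal_word (Vert # w)"
  then obtain a b where *: "Vert # w = replicate a Horiz @ replicate b Vert"
    by (auto simp: normal_word_def)
  then show "\<exists>b. w = replicate b Vert"
    by (cases a; cases b) auto
next
  assume "\<exists>b. w = replicate b Vert"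
  then obtain b where "Vert # w = replicate 0 Horiz @ replicate (Suc b) Vert" by auto
  then show "normal_word (Vert # w)" unfolding normal_word_def by blast
qed

lemma normal_word_Nil [simp]: "normal_word []"
  by (simp add: normal_word_def)

lemma lower_word_unique: "lower_word a b w \<Longrightarrow> lower_word a' b' w \<Longrightarrow> a = a' \<and> b = b'"
proof (induction w arbitrary: a b a' b')
  case (Cons s w)
  then show ?case by (cases s) (fastforce)+
qed simp

lemma lower_not_upper: "lower_word a b w \<Longrightarrow> \<not> upper_word a' b' w"
proof (induction w arbitrary: a b a' b')
  case (Cons s w)
  then show ?case by (cases s) auto
qed simp

lemma word_cases:
  obtains "normal_word w" | a b where "lower_word a b w" | a b where "upper_word a b w"
proof -
  have "normal_word w \<or> (\<exists>a b. lower_word a b w) \<or> (\<exists>a b. upper_word a b w)"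
  proof (induction w)
    case (Cons s w)
    show ?case
    proof (cases s)
      case Vert
      have "(\<exists>b. w = replicate b Vert) \<or> (\<exists>b. lower_word 0 b w)
          \<or> (\<exists>w'. w = Horiz # w') \<or> (\<exists>b. upper_word 0 b w)" for w
      proof (induction w)
        case (Cons s w)
        show ?case
        proof (cases s)
          case Vert
          from Cons consider b where "w = replicate b Vert" | b where "lower_word 0 b w"
            | w' where "w = Horiz # w'" | b where "upper_word 0 b w" by blast
          then show ?thesis
          proof cases
            case (1 b)
            then have "s # w = replicate (Suc b) Vert" using Vert by simp
            then show ?thesis by blast
          qed (auto simp: Vert ex_disj_distrib)
        qed simp_all
      qed simp
      then show ?thesis by (simp add: Vert normal_word_Vert) metis
    qed (use Cons in auto)
  qed simp
  then show ?thesis using that by blast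
qed

lemma merge_vertical:
  assumes "replicate (Suc b) Vert @ Horiz # w = A @ s # t # B"
    and "lower_word 0 b' (A @ merge s t # B)"
  shows "A = replicate b Vert \<or> b < b'"
  using assms
proof (induction b arbitrary: A b')
  case 0
  then show ?case by (cases A) auto
next
  case (Suc b)
  show ?case
  proof (cases A)
    case Nil
    with Suc.prems have "merge s t = Vert" "B = replicate b Vert @ Horiz # w"
      by (auto simp: merge_def)
    then have "A @ merge s t # B = replicate 0 Horiz @ replicate (Suc b) Vert @ Horiz # w"
      using Nil by simp
    then have "upper_word 0 b (A @ merge s t # B)"
      unfolding upper_word_def by blast
    then show ?thesis using Suc.prems(2) lower_not_upper by blast
  next
    case (Cons x A')
    with Suc show ?thesis by auto
  qed
qed

text \<open>The acyclicity of the matching. Merging two letters of an upper word gives a lower word only in two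
ways besides undoing the corner. If the last letter of the initial horizontal block merges with the
vertical letter after it, then \<open>a\<close> drops. If the horizontal letter at the obstruction merges with
a different letter after it, then all vertical letters before it survive and \<open>b\<close> grows by one.\<close>

lemma merge_upper:
  assumes "upper_word a b w" "w = A @ s # t # B" "lower_word a' b' (A @ merge s t # B)"
  shows "A = replicate a Horiz @ replicate b Vert \<or> a' < a \<or> a' = a \<and> b < b'"
  using assms
proof (induction a arbitrary: w A a')
  case 0
  then obtain w' where w: "replicate (Suc b) Vert @ Horiz # w' = A @ s # t # B"
    by (auto simp: upper_word_def)
  show ?case
  proof (cases "A = [] \<and> b = 0")
    case False
    have "hd (A @ merge s t # B) = Vert"
      using w False by (cases A; cases b) (auto simp: merge_def)
    then have "a' = 0"
      using 0(3) by (cases "A @ merge s t # B") auto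
    then show ?thesis using merge_vertical[OF w] 0(3) by auto
  qed simp
next
  case (Suc a)
  show ?case
  proof (cases A)
    case Nil
    show ?thesis
    proof (cases t)
      case Horiz
      with Suc.prems Nil have "upper_word a b (t # B)" "s = Horiz" by (auto simp: upper_word_def)
      then show ?thesis using Suc.prems(3) Nil Horiz lower_not_upper by (auto simp: merge_def)
    qed (use Suc.prems Nil in \<open>auto simp: merge_def upper_word_def\<close>)
  next
    case (Cons x A')
    with Suc.prems have x: "x = Horiz" "upper_word a b (A' @ s # t # B)" by (auto simp: upper_word_def)
    with Suc.prems Cons obtain a'' where "a' = Suc a''" "lower_word a'' b' (A' @ merge s t # B)"
      by auto
    with Suc.IH[OF x(2) refl] Cons x show ?thesis by auto
  qed
qed

section \<open>Inserting and removing corners\<close>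

context metric_pair
begin

lemma between_coordinates:
  assumes "between dXY (x, y) (x', y') (x'', y'')" "x \<in> X" "x' \<in> X" "x'' \<in> X"
    "y \<in> Y" "y' \<in> Y" "y'' \<in> Y"
  shows "between dX x x' x''" "between dY y y' y''"
  using assms(1)[unfolded l1_between] assms(2-) MX.triangle[of x x' x''] MY.triangle[of y y' y'']
  by (simp_all add: between_def)

lemma step_merge:
  assumes "between dXY a m b" "a \<in> X \<times> Y" "m \<in> X \<times> Y" "b \<in> X \<times> Y" "a \<noteq> m" "m \<noteq> b"
  shows "step a b = merge (step a m) (step m b)"
proof -
  obtain x y x' y' x'' y'' where eq: "a = (x, y)" "m = (x', y')" "b = (x'', y'')"
    by (metis surj_pair)
  have mem: "x \<in> X" "x' \<in> X" "x'' \<in> X" "y \<in> Y" "y' \<in> Y" "y'' \<in> Y"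
    using assms eq by auto
  note btw = between_coordinates[OF assms(1)[unfolded eq] mem]
  have *: "(if p \<and> p' then Vert else if q \<and> q' then Horiz else Diag)
      = merge (if p then Vert else if q then Horiz else Diag)
          (if p' then Vert else if q' then Horiz else Diag)"
    if "\<not> (p \<and> q)" "\<not> (p' \<and> q')" for p q p' q'
    using that by (auto simp: merge_def)
  have "\<not> (x = x' \<and> y = y')" "\<not> (x' = x'' \<and> y' = y'')"
    using assms(5,6) unfolding eq by simp_all
  from *[OF this] show ?thesis
    unfolding eq step.simps
      MX.between_eq_iff[OF btw(1) mem(1-3)] MY.between_eq_iff[OF btw(2) mem(4-6)] .
qed

text \<open>An upper path arises from a lower path by inserting the corner \<open>(fst u, snd v)\<close> into its first
diagonal step.\<close>

lemma upper_pathE: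
  assumes "f \<in> paths (X \<times> Y) k" "upper_word a b (word f)"
  obtains A u v B where "f = A @ u # (fst u, snd v) # v # B"
    "word (A @ [u]) = replicate a Horiz @ replicate b Vert" "length A = a + b"
    "A @ u # v # B \<in> paths (X \<times> Y) (k - 1)" "lower_word a b (word (A @ u # v # B))"
proof -
  obtain w where w: "word f = (replicate a Horiz @ replicate b Vert) @ Vert # Horiz # w"
    using assms(2) by (auto simp: upper_word_def replicate_app_Cons_same)
  obtain A u c B1 where 1: "f = A @ u # c # B1"
    "word (A @ [u]) = replicate a Horiz @ replicate b Vert" "step u c = Vert"
    "word (c # B1) = Horiz # w" "length A = length (replicate a Horiz @ replicate b Vert)"
    by (rule word_split[OF w])
  then obtain v B where 2: "B1 = v # B" "step c v = Horiz" "word (v # B) = w"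
    by (cases B1) auto
  have c: "c = (fst u, snd v)" "fst u \<noteq> fst v" "snd u \<noteq> snd v"
    using 1 2 assms(1) by (auto simp: paths_iff distinct_adj_append_iff prod_eq_iff step_eq_iff)
  have D: "step u v = Diag" using c by (simp add: step_eq_iff)
  show ?thesis
  proof (rule that[of A u v B])
    show "f = A @ u # (fst u, snd v) # v # B" using 1 2 c by simp
    show "A @ u # v # B \<in> paths (X \<times> Y) (k - 1)"
      using 1 2 c assms(1) by (auto simp: paths_iff distinct_adj_append_iff)
    show "lower_word a b (word (A @ u # v # B))"
      using 1 D by (simp add: word_append[of A u "v # B"] lower_word_def)
  qed (use 1 in auto)
qed

lemma lower_pathE:
  assumes "\<rho> \<in> paths (X \<times> Y) k" "lower_word a b (word \<rho>)"
  obtains A u v B where "\<rho> = A @ u # v # B" "length A = a + b"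
    "A @ u # (fst u, snd v) # v # B \<in> paths (X \<times> Y) (k + 1)"
    "upper_word a b (word (A @ u # (fst u, snd v) # v # B))"
proof -
  obtain w where w: "word \<rho> = (replicate a Horiz @ replicate b Vert) @ Diag # w"
    using assms(2) by (auto simp: lower_word_def)
  obtain A u v B where 1: "\<rho> = A @ u # v # B"
    "word (A @ [u]) = replicate a Horiz @ replicate b Vert" "step u v = Diag"
    "word (v # B) = w" "length A = length (replicate a Horiz @ replicate b Vert)"
    by (rule word_split[OF w])
  let ?c = "(fst u, snd v)"
  have c: "fst u \<noteq> fst v" "snd u \<noteq> snd v"
    using 1(3) by (simp_all add: step_eq_iff)
  have VH: "step u ?c = Vert" "step ?c v = Horiz" using c by (simp_all add: step_eq_iff)
  show ?thesis
  proof (rule that[of A u v B])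
    show "A @ u # ?c # v # B \<in> paths (X \<times> Y) (k + 1)"
      using 1 c assms(1) by (cases u; cases v) (auto simp: paths_iff distinct_adj_append_iff)
    show "upper_word a b (word (A @ u # ?c # v # B))"
      using 1 VH by (simp add: word_append[of A u "?c # v # B"] upper_word_def
          replicate_app_Cons_same)
  qed (use 1 in auto)
qed

text \<open>One face of an upper path is its partner in the matching, with coefficient \<open>1\<close> or \<open>-1\<close>. Every
other face is either not lower or strictly smaller in the order of \<open>merge_upper\<close>.\<close>

lemma corner_face:
  assumes f: "A @ u # (fst u, snd v) # v # B \<in> paths (X \<times> Y) k"
    and up: "upper_word a b (word (A @ u # (fst u, snd v) # v # B))" and len: "length A = a + b"
  obtains e R where "e * e = (1::int)"
    "path_bd dXY (A @ u # (fst u, snd v) # v # B) = frag_cmul e (frag_of (A @ u # v # B)) + R"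
    "keys R \<subseteq> paths (X \<times> Y) (k - 1)"
    "\<And>\<sigma> a' b'. \<sigma> \<in> keys R \<Longrightarrow> lower_word a' b' (word \<sigma>) \<Longrightarrow> a' < a \<or> a' = a \<and> b < b'"
proof -
  let ?f = "A @ u # (fst u, snd v) # v # B"
  obtain R where R: "path_bd dXY ?f = frag_cmul ((-1) ^ Suc (length A))
      (if between dXY u (fst u, snd v) v then frag_of (A @ u # v # B) else 0) + R"
    "\<And>\<sigma>. \<sigma> \<in> keys R \<Longrightarrow> \<exists>A' x m' y B'. ?f = A' @ x # m' # y # B'
        \<and> \<sigma> = A' @ x # y # B' \<and> between dXY x m' y \<and> length A' \<noteq> length A"
    by (rule path_bd_isolate_face) blast
  have "between dXY u (fst u, snd v) v"
    using f by (cases u; cases v) (auto simp: paths_iff)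
  then have "path_bd dXY ?f = frag_cmul ((-1) ^ Suc (length A)) (frag_of (A @ u # v # B)) + R"
    using R(1) by simp
  moreover have "keys R \<subseteq> paths (X \<times> Y) (k - 1)"
  proof
    fix \<sigma> assume "\<sigma> \<in> keys R"
    from R(2)[OF this] obtain A' x m' y B' where *: "?f = A' @ x # m' # y # B'"
        "\<sigma> = A' @ x # y # B'" "between dXY x m' y" by blast
    then show "\<sigma> \<in> paths (X \<times> Y) (k - 1)"
      using MXY.face_in_paths[of A' x m' y B' k] f by simp
  qed
  moreover have "a' < a \<or> a' = a \<and> b < b'"
    if \<sigma>: "\<sigma> \<in> keys R" and low: "lower_word a' b' (word \<sigma>)" for \<sigma> a' b'
  proof -
    from R(2)[OF \<sigma>] obtain A' x m' y B' where *: "?f = A' @ x # m' # y # B'"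
        "\<sigma> = A' @ x # y # B'" "between dXY x m' y" "length A' \<noteq> length A" by blast
    have w\<sigma>: "word \<sigma> = word (A' @ [x]) @ merge (step x m') (step m' y) # word (y # B')"
      using step_merge[of x m' y] *(3) f unfolding *(1,2) word_append[of A' x "y # B'"]
      by (auto simp: paths_iff distinct_adj_append_iff)
    have wf: "word ?f = word (A' @ [x]) @ step x m' # step m' y # word (y # B')"
      unfolding *(1) by (simp add: word_append[of A' x "m' # y # B'"])
    from merge_upper[OF up wf] low w\<sigma>
    have "word (A' @ [x]) = replicate a Horiz @ replicate b Vert \<or> a' < a \<or> a' = a \<and> b < b'"
      by simp
    moreover have "word (A' @ [x]) \<noteq> replicate a Horiz @ replicate b Vert"
    proof
      assume "word (A' @ [x]) = replicate a Horiz @ replicate b Vert"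
      from arg_cong[OF this, of length] show False using *(4) len by simp
    qed
    ultimately show ?thesis by blast
  qed
  ultimately show ?thesis
    using that[of "(-1) ^ Suc (length A)" R] by (simp flip: power_add mult_2)
qed

text \<open>Encodes by a natural number the lexicographic order in which \<open>a\<close> ascends and \<open>b\<close>, which is at
most \<open>k\<close>, descends.\<close>

definition rank :: "nat \<Rightarrow> nat \<Rightarrow> nat \<Rightarrow> nat" where
  "rank k a b = a * (k + 1) + (k - b)"

lemma rank_less:
  assumes "a' < a \<or> a' = a \<and> b < b'" "b' \<le> k"
  shows "rank k a' b' < rank k a b"
  using assms(1)
proof
  assume "a' < a"
  then have "a' * (k + 1) + (k + 1) \<le> a * (k + 1)"
    by (metis Suc_leI add.commute mult_Suc mult_le_mono1)
  then show ?thesis by (simp add: rank_def)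
qed (use assms(2) in \<open>auto simp: rank_def\<close>)

lemma lower_word_bound: "lower_word a b w \<Longrightarrow> b \<le> length w"
  by (auto simp: lower_word_def)

lemma lower_word_bound_path: "lower_word a b (word \<sigma>) \<Longrightarrow> \<sigma> \<in> paths (X \<times> Y) k \<Longrightarrow> b \<le> k"
  using lower_word_bound[of a b "word \<sigma>"] by (simp add: paths_iff)

definition nonlower_paths :: "nat \<Rightarrow> ('a \<times> 'b) list set" where
  "nonlower_paths k = {\<sigma> \<in> paths (X \<times> Y) k. \<forall>a b. \<not> lower_word a b (word \<sigma>)}"

definition reducible :: "nat \<Rightarrow> (('a \<times> 'b) list \<Rightarrow>\<^sub>0 int) \<Rightarrow> bool" where
  "reducible k c \<longleftrightarrow> (\<exists>g. keys g \<subseteq> paths (X \<times> Y) (k + 1) \<and> keys (c - bd dXY g) \<subseteq> nonlower_paths k)"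

lemma reducible_diff:
  assumes "reducible k c" "reducible k c'"
  shows "reducible k (c - c')"
proof -
  obtain g g' where g: "keys g \<subseteq> paths (X \<times> Y) (k + 1)" "keys (c - bd dXY g) \<subseteq> nonlower_paths k"
    "keys g' \<subseteq> paths (X \<times> Y) (k + 1)" "keys (c' - bd dXY g') \<subseteq> nonlower_paths k"
    using assms unfolding reducible_def by blast
  have eq: "(c - c') - bd dXY (g - g') = (c - bd dXY g) - (c' - bd dXY g')" by simp
  show ?thesis
    unfolding reducible_def
    by (rule exI[of _ "g - g'"], subst eq) (intro conjI keys_diff_subset g)
qed

lemma reducible_0: "reducible k 0"
  unfolding reducible_def by (rule exI[of _ 0]) simp

lemma reducible_chain:
  assumes "\<And>\<sigma>. \<sigma> \<in> keys c \<Longrightarrow> reducible k (frag_of \<sigma>)"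
  shows "reducible k c"
proof -
  have "keys c \<subseteq> {\<sigma>. reducible k (frag_of \<sigma>)}" using assms by blast
  then show ?thesis
    by (induction c rule: frag_induction) (auto intro: reducible_0 reducible_diff)
qed

text \<open>Up to sign, a lower path is the boundary of its partner plus chains of smaller rank, so induction on
the rank replaces it by paths that are not lower.\<close>

lemma reducible_path:
  assumes "\<rho> \<in> paths (X \<times> Y) k"
  shows "reducible k (frag_of \<rho>)"
proof -
  have nonlower: "reducible k (frag_of \<sigma>)" if "\<sigma> \<in> nonlower_paths k" for \<sigma>
    unfolding reducible_def by (rule exI[of _ 0]) (use that in simp)
  have lower: "reducible k (frag_of \<rho>)"
    if "\<rho> \<in> paths (X \<times> Y) k" "lower_word a b (word \<rho>)" "rank k a b = n" for n a b \<rho>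
    using that
  proof (induction n arbitrary: a b \<rho> rule: less_induct)
    case (less n)
    obtain A u v B where \<rho>: "\<rho> = A @ u # v # B" "length A = a + b"
      "A @ u # (fst u, snd v) # v # B \<in> paths (X \<times> Y) (k + 1)"
      "upper_word a b (word (A @ u # (fst u, snd v) # v # B))"
      using lower_pathE[OF less.prems(1,2)] by blast
    let ?f = "A @ u # (fst u, snd v) # v # B"
    obtain e R where eR: "e * e = 1" "path_bd dXY ?f = frag_cmul e (frag_of \<rho>) + R"
      "keys R \<subseteq> paths (X \<times> Y) k"
      "\<And>\<sigma> a' b'. \<sigma> \<in> keys R \<Longrightarrow> lower_word a' b' (word \<sigma>) \<Longrightarrow> a' < a \<or> a' = a \<and> b < b'"
      using corner_face[OF \<rho>(3,4,2)] \<rho>(1) by auto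
    have "reducible k (frag_cmul e R)"
    proof (rule reducible_chain)
      fix \<sigma> assume "\<sigma> \<in> keys (frag_cmul e R)"
      then have \<sigma>: "\<sigma> \<in> keys R" by simp
      then have path: "\<sigma> \<in> paths (X \<times> Y) k" using eR(3) by blast
      show "reducible k (frag_of \<sigma>)"
      proof (cases "\<sigma> \<in> nonlower_paths k")
        case False
        then obtain a' b' where low: "lower_word a' b' (word \<sigma>)"
          using path by (auto simp: nonlower_paths_def)
        have "rank k a' b' < n"
          using rank_less[OF eR(4)[OF \<sigma> low] lower_word_bound_path[OF low path]] less.prems(3)
          by simp
        then show ?thesis using less.IH[OF _ path low refl] by blast
      qed (rule nonlower)
    qed
    moreover have "reducible k (frag_cmul e (path_bd dXY ?f))"
      unfolding reducible_def
      by (rule exI[of _ "frag_cmul e (frag_of ?f)"]) (use \<rho>(3) eR(1) in auto)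
    moreover have "frag_of \<rho> = frag_cmul e (path_bd dXY ?f) - frag_cmul e R"
      unfolding eR(2) using eR(1) by (simp add: frag_cmul_distrib2)
    ultimately show ?case using reducible_diff by simp
  qed
  show ?thesis
  proof (cases "\<rho> \<in> nonlower_paths k")
    case False
    then show ?thesis using assms lower by (auto simp: nonlower_paths_def)
  qed (rule nonlower)
qed

proposition chain_reducible: "keys c \<subseteq> paths (X \<times> Y) k \<Longrightarrow> reducible k c"
  by (rule reducible_chain) (use reducible_path in blast)

text \<open>Take an upper path in the chain with partner \<open>\<rho>\<close> of maximal rank. By \<open>corner_face\<close> no other upper
path in the chain has \<open>\<rho>\<close> as a face, so \<open>\<rho>\<close> cannot cancel in the boundary.\<close>

proposition upper_chain_eq_0:
  assumes c: "keys c \<subseteq> paths (X \<times> Y) k" "\<And>f. f \<in> keys c \<Longrightarrow> \<exists>a b. upper_word a b (word f)"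
    and bd: "\<And>\<sigma> a b. \<sigma> \<in> keys (bd dXY c) \<Longrightarrow> \<not> lower_word a b (word \<sigma>)"
  shows "c = 0"
proof (rule ccontr)
  assume "c \<noteq> 0"
  then have ne: "keys c \<noteq> {}" by simp
  have "\<exists>h. \<forall>f\<in>keys c. upper_word (fst (h f)) (snd (h f)) (word f)"
    by (rule bchoice) (use c(2) in auto)
  then obtain h where h: "\<And>f. f \<in> keys c \<Longrightarrow> upper_word (fst (h f)) (snd (h f)) (word f)"
    by blast
  define r where "r f = rank (k - 1) (fst (h f)) (snd (h f))" for f
  have fin: "finite (r ` keys c)" "r ` keys c \<noteq> {}" using ne by auto
  obtain f where f: "f \<in> keys c" "r f = Max (r ` keys c)"
    using Max_in[OF fin] by auto
  have r_max: "r g \<le> r f" if "g \<in> keys c" for g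
    using Max_ge[OF fin(1), of "r g"] that f(2) by simp
  have upper: "\<exists>A u v B e R. g = A @ u # (fst u, snd v) # v # B \<and> length A = fst (h g) + snd (h g)
      \<and> A @ u # v # B \<in> paths (X \<times> Y) (k - 1)
      \<and> lower_word (fst (h g)) (snd (h g)) (word (A @ u # v # B))
      \<and> e * e = 1 \<and> path_bd dXY g = frag_cmul e (frag_of (A @ u # v # B)) + R
      \<and> (\<forall>\<sigma>\<in>keys R. \<forall>a' b'. lower_word a' b' (word \<sigma>) \<longrightarrow> b' \<le> k - 1 \<longrightarrow> rank (k - 1) a' b' < r g)"
    if g: "g \<in> keys c" for g
  proof -
    have path: "g \<in> paths (X \<times> Y) k" using g c(1) by blast
    obtain A u v B where *: "g = A @ u # (fst u, snd v) # v # B"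
      "length A = fst (h g) + snd (h g)" "A @ u # v # B \<in> paths (X \<times> Y) (k - 1)"
      "lower_word (fst (h g)) (snd (h g)) (word (A @ u # v # B))"
      using upper_pathE[OF path h[OF g]] by metis
    obtain e R where "e * e = 1" "path_bd dXY g = frag_cmul e (frag_of (A @ u # v # B)) + R"
      "\<And>\<sigma> a' b'. \<sigma> \<in> keys R \<Longrightarrow> lower_word a' b' (word \<sigma>) \<Longrightarrow>
        a' < fst (h g) \<or> a' = fst (h g) \<and> snd (h g) < b'"
      using corner_face[OF path[unfolded *(1)] h[OF g, unfolded *(1)]] *(1,2) by metis
    then show ?thesis
      using * unfolding r_def by (intro exI[of _ A] exI[of _ u] exI[of _ v] exI[of _ B]
          exI[of _ e] exI[of _ R]) (auto intro: rank_less)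
  qed
  obtain A u v B e R where F: "f = A @ u # (fst u, snd v) # v # B" "length A = fst (h f) + snd (h f)"
      "A @ u # v # B \<in> paths (X \<times> Y) (k - 1)"
      "lower_word (fst (h f)) (snd (h f)) (word (A @ u # v # B))"
      "e * e = 1" "path_bd dXY f = frag_cmul e (frag_of (A @ u # v # B)) + R"
      "\<And>\<sigma> a' b'. \<sigma>\<in>keys R \<Longrightarrow> lower_word a' b' (word \<sigma>) \<Longrightarrow> b' \<le> k - 1 \<Longrightarrow> rank (k - 1) a' b' < r f"
    using upper[OF f(1)] by metis
  define \<rho> where "\<rho> = A @ u # v # B"
  have bound: "snd (h f) \<le> k - 1" by (rule lower_word_bound_path[OF F(4,3)])
  have others: "lookup (path_bd dXY g) \<rho> = 0" if g: "g \<in> keys c" "g \<noteq> f" for g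
  proof -
    obtain A' u' v' B' e' R' where G: "g = A' @ u' # (fst u', snd v') # v' # B'"
      "length A' = fst (h g) + snd (h g)"
      "lower_word (fst (h g)) (snd (h g)) (word (A' @ u' # v' # B'))"
      "path_bd dXY g = frag_cmul e' (frag_of (A' @ u' # v' # B')) + R'"
      "\<And>\<sigma> a' b'. \<sigma>\<in>keys R' \<Longrightarrow> lower_word a' b' (word \<sigma>) \<Longrightarrow> b' \<le> k - 1 \<Longrightarrow> rank (k - 1) a' b' < r g"
      using upper[OF g(1)] by metis
    have "\<rho> \<notin> keys R'"
      using G(5)[of \<rho>] F(4) bound r_max[OF g(1)] unfolding \<rho>_def r_def by fastforce
    moreover have "A' @ u' # v' # B' \<noteq> \<rho>"
    proof
      assume eq: "A' @ u' # v' # B' = \<rho>"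
      then have "length A' = length A"
        using lower_word_unique[OF G(3)[unfolded eq] F(4)[folded \<rho>_def]] G(2) F(2) by simp
      then show False using eq g(2) unfolding \<rho>_def G(1) F(1) by simp
    qed
    ultimately show ?thesis
      unfolding G(4) by (simp add: lookup_add in_keys_iff)
  qed
  have "\<rho> \<notin> keys R"
    using F(7)[of \<rho>] F(4) bound unfolding \<rho>_def r_def by blast
  then have self: "lookup (path_bd dXY f) \<rho> = e"
    unfolding F(6) by (simp add: lookup_add in_keys_iff \<rho>_def)
  have "lookup (bd dXY c) \<rho> = (\<Sum>g\<in>keys c. lookup c g * lookup (path_bd dXY g) \<rho>)"
    unfolding bd_def by (rule lookup_frag_extend)
  also have "\<dots> = (\<Sum>g\<in>{f}. lookup c g * lookup (path_bd dXY g) \<rho>)"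
    by (rule sum.mono_neutral_right) (use f(1) others in auto)
  finally have "lookup (bd dXY c) \<rho> \<noteq> 0"
    using self F(5) f(1) by (auto simp: in_keys_iff)
  then show False
    using bd[of \<rho>] F(4) by (auto simp: in_keys_iff \<rho>_def)
qed

end

section \<open>Cycles of the product are shuffles\<close>

lemma shuffle_length_set:
  assumes "l \<in> keys (shuffle p q)"
  shows "length l = length p + length q - 1 \<and> set l \<subseteq> set p \<times> set q"
  using assms
proof (induction p q arbitrary: l rule: shuffle.induct)
  case (1 x p y q)
  show ?case
  proof (cases "p = [] \<and> q = []")
    case True
    then show ?thesis using 1(3) by simp
  next
    case False
    from 1(3) show ?thesis
    proof (cases rule: shuffle_keysE)
      case (2 l')
      then show ?thesis using 1(1)[OF False, of l'] by auto
    next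
      case (3 l')
      then show ?thesis using 1(2)[OF False, of l'] by auto
    qed (use False in simp)
  qed
qed simp_all

text \<open>A step of a shuffle is a step of \<open>p\<close> or of \<open>q\<close> with the other coordinate fixed. This one
induction serves three times: for distinctness of consecutive points, for the absence of diagonal
steps and for saturation.\<close>

lemma shuffle_successively:
  assumes "l \<in> keys (shuffle p q)" "successively P p" "successively R q"
    and "\<And>x x' y. P x x' \<Longrightarrow> x \<in> set p \<Longrightarrow> x' \<in> set p \<Longrightarrow> y \<in> set q \<Longrightarrow> Q (x, y) (x', y)"
    and "\<And>x y y'. R y y' \<Longrightarrow> x \<in> set p \<Longrightarrow> y \<in> set q \<Longrightarrow> y' \<in> set q \<Longrightarrow> Q (x, y) (x, y')"
  shows "successively Q l"
  using assms
proof (induction p q arbitrary: l rule: shuffle.induct)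
  case (1 x p y q)
  show ?case
  proof (cases "p = [] \<and> q = []")
    case True
    then show ?thesis using 1(3) by simp
  next
    case False
    from 1(3) show ?thesis
    proof (cases rule: shuffle_keysE)
      case (2 l')
      then obtain x' p' where p: "p = x' # p'" by (cases p) auto
      have "Q (x, y) (x', y)" using 1(4,6) p by auto
      moreover have "l' \<noteq> [] \<and> hd l' = (x', y)" using 2(2) p shuffle_hd by metis
      moreover have "successively Q l'"
        using 1(4-7) by (intro 1(1)[OF False 2(2)]) (auto simp: successively_Cons)
      ultimately show ?thesis using 2(1) by (simp add: successively_Cons)
    next
      case (3 l')
      then obtain y' q' where q: "q = y' # q'" by (cases q) auto
      have "Q (x, y) (x, y')" using 1(5,7) q by auto
      moreover have "l' \<noteq> [] \<and> hd l' = (x, y')" using 3(2) q shuffle_hd by metis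
      moreover have "successively Q l'"
        using 1(4-7) by (intro 1(2)[OF False 3(2)]) (auto simp: successively_Cons)
      ultimately show ?thesis using 3(1) by (simp add: successively_Cons)
    qed (use False in simp)
  qed
qed simp_all

lemma Diag_notin_word: "successively (\<lambda>a b. step a b \<noteq> Diag) l \<Longrightarrow> Diag \<notin> set (word l)"
  by (induction l rule: word.induct) auto

lemma shuffle_no_Diag:
  assumes "l \<in> keys (shuffle p q)"
  shows "Diag \<notin> set (word l)"
  by (rule Diag_notin_word,
      rule shuffle_successively[OF assms, where P = "\<lambda>_ _. True" and R = "\<lambda>_ _. True"])
    (auto simp: successively_conv_nth)

lemma lower_word_Diag: "lower_word a b w \<Longrightarrow> Diag \<in> set w"
  by (auto simp: lower_word_def)

text \<open>The shuffle that first runs through \<open>p\<close> and then through \<open>q\<close>. It occurs with coefficient \<open>1\<close>,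
and it determines \<open>p\<close> and \<open>q\<close>.\<close>

definition straight_path :: "'a list \<Rightarrow> 'b list \<Rightarrow> ('a \<times> 'b) list" where
  "straight_path p q = map (\<lambda>x. (x, hd q)) p @ map (\<lambda>y. (last p, y)) (tl q)"

lemma straight_path_singleton: "q \<noteq> [] \<Longrightarrow> straight_path [x] q = map (Pair x) q"
  by (cases q) (auto simp: straight_path_def)

lemma straight_path_Cons: "p \<noteq> [] \<Longrightarrow> straight_path (x # p) q = (x, hd q) # straight_path p q"
  by (auto simp: straight_path_def)

lemma hd_straight_path: "p \<noteq> [] \<Longrightarrow> hd (straight_path p q) = (hd p, hd q) \<and> straight_path p q \<noteq> []"
  by (cases p) (auto simp: straight_path_def)

lemma word_map_Pair:
  "word (map (Pair x) q) = replicate (length q - 1) Vert"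
proof (induction q)
  case (Cons y q)
  then show ?case by (cases q) auto
qed simp

lemma word_straight_path:
  assumes "p \<noteq> []" "q \<noteq> []" "distinct_adj p"
  shows "word (straight_path p q) = replicate (length p - 1) Horiz @ replicate (length q - 1) Vert"
  using assms(1,3)
proof (induction p rule: list_nonempty_induct)
  case (single x)
  then show ?case using assms(2) by (simp add: straight_path_singleton word_map_Pair)
next
  case (cons x p)
  then have "word (straight_path (x # p) q) = Horiz # word (straight_path p q)"
    using hd_straight_path[of p q]
    by (auto simp: straight_path_Cons word_Cons distinct_adj_Cons)
  moreover have "replicate (length p) Horiz = Horiz # replicate (length p - 1) Horiz"
    using cons(1) by (cases p) auto
  ultimately show ?case using cons by (auto simp: distinct_adj_Cons)
qed

lemma normal_straight_path:
  "p \<noteq> [] \<Longrightarrow> q \<noteq> [] \<Longrightarrow> distinct_adj p \<Longrightarrow> normal_word (word (straight_path p q))"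
  using word_straight_path unfolding normal_word_def by blast

lemma straight_path_inject:
  assumes eq: "straight_path p q = straight_path p' q'"
    and p: "p \<noteq> []" "distinct_adj p" "p' \<noteq> []" "distinct_adj p'" and q: "q \<noteq> []" "q' \<noteq> []"
  shows "p = p' \<and> q = q'"
proof -
  have "length (filter ((=) Horiz) (word (straight_path p q)))
      = length (filter ((=) Horiz) (word (straight_path p' q')))"
    by (simp only: eq)
  then have "length p - 1 = length p' - 1"
    unfolding word_straight_path[OF p(1) q(1) p(2)] word_straight_path[OF p(3) q(2) p(4)]
    by simp
  then have len: "length p = length p'"
    using p by (cases p; cases p'; simp)
  have "map fst (straight_path p q) = p @ map (\<lambda>_. last p) (tl q)" for p :: "'a list" and q :: "'b list"
    by (simp add: straight_path_def comp_def)
  from this[of p q] this[of p' q'] have pp: "p = p'" using eq len by simp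
  have "map snd (straight_path p q) = map (\<lambda>_. hd q) p @ tl q" for p :: "'a list" and q :: "'b list"
    by (simp add: straight_path_def comp_def)
  from this[of p q] this[of p' q'] have "map (\<lambda>_. hd q) p = map (\<lambda>_. hd q') p \<and> tl q = tl q'"
    using eq len pp by simp
  then have "hd q = hd q'" "tl q = tl q'" using p by (cases p; simp)+
  then show ?thesis using pp q by (metis list.expand)
qed

lemma shuffle_Horiz:
  assumes "l \<in> keys (shuffle p q)" "distinct_adj p" "length p \<ge> 2"
  shows "Horiz \<in> set (word l)"
  using assms
proof (induction p q arbitrary: l rule: shuffle.induct)
  case (1 x p y q)
  then obtain x' p' where p: "p = x' # p'" by (cases p) auto
  then have ne: "\<not> (p = [] \<and> q = [])" by simp
  from 1(3) show ?case
  proof (cases rule: shuffle_keysE)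
    case (2 l')
    have "l' \<noteq> [] \<and> hd l' = (x', y)" using 2(2) p shuffle_hd by metis
    then show ?thesis using 2 1(4) p by (auto simp: word_Cons)
  next
    case (3 l')
    have "l' \<noteq> []" using 3(2) shuffle_hd[of l' x p "hd q" "tl q"] by (cases q) auto
    then show ?thesis using 3 1(2)[OF ne 3(2)] 1(4,5) by (auto simp: word_Cons)
  qed (use p in simp)
qed simp_all

text \<open>Every shuffle other than the straight one makes a vertical step before a horizontal one.\<close>

lemma shuffle_straight_path:
  assumes "p \<noteq> []" "q \<noteq> []" "distinct_adj p" "distinct_adj q"
  obtains R where "shuffle p q = frag_of (straight_path p q) + R"
    "\<And>l. l \<in> keys R \<Longrightarrow> \<not> normal_word (word l)" "keys R \<subseteq> keys (shuffle p q)"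
  using assms
proof (induction p q arbitrary: thesis rule: shuffle.induct)
  case (1 x p y q)
  show ?case
  proof (cases "p = [] \<and> q = []")
    case True
    then show ?thesis using 1(3)[of 0] by (simp add: straight_path_def)
  next
    case False
    let ?c = "cons_chain (x, y)"
    have sh: "shuffle (x # p) (y # q)
        = ?c (shuffle p (y # q)) + frag_cmul ((-1) ^ length p) (?c (shuffle (x # p) q))"
      using False by (simp add: shuffle_Cons_Cons)
    have "\<exists>R. shuffle (x # p) (y # q) = frag_of (straight_path (x # p) (y # q)) + R
      \<and> (\<forall>l\<in>keys R. \<not> normal_word (word l))"
    proof (cases "p = []")
      case True
      then have q: "q \<noteq> []" using False by simp
      obtain R where R: "shuffle [x] q = frag_of (straight_path [x] q) + R"
        "\<And>l. l \<in> keys R \<Longrightarrow> \<not> normal_word (word l)" "keys R \<subseteq> keys (shuffle [x] q)"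
        using 1(2)[OF False] True q 1(7) by (auto simp: distinct_adj_Cons)
      have "\<not> normal_word (word l)" if l: "l \<in> keys (?c R)" for l
      proof -
        obtain l' where l': "l = (x, y) # l'" "l' \<in> keys R"
          using l keys_cons_chain[of "(x, y)" R] by blast
        then have "l' \<in> keys (shuffle [x] q)" using R(3) by blast
        then have "l' \<noteq> [] \<and> hd l' = (x, hd q)"
          using q shuffle_hd[of l' x "[]" "hd q" "tl q"] by simp
        then have "word l = Vert # word l'" using l' by (simp add: word_Cons)
        moreover have "\<not> normal_word (word l')" using R(2) l' by blast
        ultimately show ?thesis
          by (metis append_Nil normal_word_Vert normal_word_def replicate_0)
      qed
      moreover have "shuffle (x # p) (y # q) = frag_of (straight_path (x # p) (y # q)) + ?c R"
        unfolding sh using True R(1) q by (simp add: straight_path_singleton)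
      ultimately show ?thesis by blast
    next
      case p: False
      obtain R where R: "shuffle p (y # q) = frag_of (straight_path p (y # q)) + R"
        "\<And>l. l \<in> keys R \<Longrightarrow> \<not> normal_word (word l)" "keys R \<subseteq> keys (shuffle p (y # q))"
        using 1(1)[OF False] p 1(6,7) by (auto simp: distinct_adj_Cons)
      let ?R = "?c R + frag_cmul ((-1) ^ length p) (?c (shuffle (x # p) q))"
      have "\<not> normal_word (word l)" if "l \<in> keys ?R" for l
        using that
      proof (rule keys_addE)
        assume "l \<in> keys (?c R)"
        then obtain l' where l': "l = (x, y) # l'" "l' \<in> keys R"
          using keys_cons_chain[of "(x, y)" R] by blast
        then have "l' \<in> keys (shuffle p (y # q))" using R(3) by blast
        then have "l' \<noteq> [] \<and> hd l' = (hd p, y)"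
          using p shuffle_hd[of l' "hd p" "tl p" y q] by simp
        then have "word l = Horiz # word l'"
          using l' 1(6) p by (auto simp: word_Cons distinct_adj_Cons)
        then show ?thesis using R(2) l' by simp
      next
        assume "l \<in> keys (frag_cmul ((-1) ^ length p) (?c (shuffle (x # p) q)))"
        then obtain l' where l': "l = (x, y) # l'" "l' \<in> keys (shuffle (x # p) q)"
          using keys_cons_chain[of "(x, y)" "shuffle (x # p) q"] by auto
        then have "q \<noteq> []" by auto
        then have "l' \<noteq> [] \<and> hd l' = (x, hd q)"
          using l' shuffle_hd[of l' x p "hd q" "tl q"] by simp
        then have "word l = Vert # word l'"
          using l' by (auto simp: word_Cons)
        moreover have "Horiz \<in> set (word l')"
          using shuffle_Horiz[OF l'(2)] 1(6) p by (cases p) auto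
        ultimately show ?thesis by (auto simp: normal_word_Vert)
      qed
      moreover have "shuffle (x # p) (y # q) = frag_of (straight_path (x # p) (y # q)) + ?R"
        unfolding sh R(1) using p by (simp add: straight_path_Cons)
      ultimately show ?thesis by blast
    qed
    then obtain R where R: "shuffle (x # p) (y # q) = frag_of (straight_path (x # p) (y # q)) + R"
      "\<forall>l\<in>keys R. \<not> normal_word (word l)" by blast
    have "keys R \<subseteq> keys (shuffle (x # p) (y # q))"
    proof
      fix l assume l: "l \<in> keys R"
      then have "l \<noteq> straight_path (x # p) (y # q)"
        using R(2) normal_straight_path[of "x # p" "y # q"] 1(6) by auto
      then show "l \<in> keys (shuffle (x # p) (y # q))"
        using l unfolding R(1) by (simp add: in_keys_iff lookup_add)
    qed
    then show ?thesis using R 1(3) by blast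
  qed
qed simp_all

lemma normal_wordE:
  assumes "normal_word (word l)" "l \<noteq> []" "distinct_adj l"
  obtains p q where "l = straight_path p q" "p \<noteq> []" "q \<noteq> []" "distinct_adj p" "distinct_adj q"
    "set p \<subseteq> fst ` set l" "set q \<subseteq> snd ` set l"
  using assms
proof (induction l arbitrary: thesis rule: word.induct)
  case (1 a b l)
  have dia: "\<not> normal_word (Diag # w)" for w
  proof
    assume "normal_word (Diag # w)"
    then obtain m n where "Diag # w = replicate m Horiz @ replicate n Vert"
      by (auto simp: normal_word_def)
    then show False by (cases m; cases n) auto
  qed
  have normal: "normal_word (word (b # l))"
  proof (cases "step a b")
    case Vert
    then obtain n where "word (b # l) = replicate 0 Horiz @ replicate n Vert"
      using 1(3) by (auto simp: normal_word_Vert)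
    then show ?thesis unfolding normal_word_def by blast
  qed (use 1(3) dia in auto)
  obtain p q where pq: "b # l = straight_path p q" "p \<noteq> []" "q \<noteq> []" "distinct_adj p" "distinct_adj q"
    "set p \<subseteq> fst ` set (b # l)" "set q \<subseteq> snd ` set (b # l)"
    using 1(1)[OF _ normal] 1(5) by auto
  have b: "b = (hd p, hd q)" using hd_straight_path[of p q] pq by (metis list.sel(1))
  show ?case
  proof (cases "step a b")
    case Horiz
    then have "fst a \<noteq> hd p" "snd a = hd q" by (simp_all add: step_eq_iff b)
    then show ?thesis
      using pq by (intro 1(2)[of "fst a # p" q])
        (auto simp: straight_path_Cons distinct_adj_Cons prod_eq_iff)
  next
    case Vert
    then obtain n where n: "word (b # l) = replicate n Vert"
      using 1(3) by (auto simp: normal_word_Vert)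
    have "length p = 1"
    proof (rule ccontr)
      assume "length p \<noteq> 1"
      then have "length p - 1 \<noteq> 0" using pq(2) by (cases p) auto
      then have "Horiz \<in> set (word (straight_path p q))"
        by (simp add: word_straight_path[OF pq(2,3,4)])
      then show False using n pq(1) by simp
    qed
    then have p: "p = [hd p]" by (cases p) auto
    have "fst a = hd p" "snd a \<noteq> hd q" using Vert 1(5) by (auto simp: step_eq_iff b prod_eq_iff)
    moreover have "b # l = map (Pair (hd p)) q"
      using pq(1,3) straight_path_singleton[of q "hd p"] p by metis
    ultimately have "a # b # l = straight_path p (snd a # q)"
      by (subst p, subst straight_path_singleton) (auto simp: prod_eq_iff)
    moreover have "set p \<subseteq> fst ` set (a # b # l)" "set (snd a # q) \<subseteq> snd ` set (a # b # l)"
      using pq(6,7) by auto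
    ultimately show ?thesis
      using pq(2-5) \<open>snd a \<noteq> hd q\<close> 1(2)[of p "snd a # q"] by (simp add: distinct_adj_Cons)
  qed (use 1(3) dia in simp)
next
  case ("2_2" a)
  then show ?case
    by (intro "2_2"(1)[of "[fst a]" "[snd a]"]) (auto simp: straight_path_def)
qed simp

context metric_pair
begin

lemma shuffle_in_paths:
  assumes "(p, q) \<in> product_paths k" "l \<in> keys (shuffle p q)"
  shows "l \<in> paths (X \<times> Y) k"
proof -
  obtain i j where ij: "i + j = k" "p \<in> paths X i" "q \<in> paths Y j"
    using assms(1) by (rule product_pathsE)
  have "distinct_adj l"
    unfolding distinct_adj_def
    by (rule shuffle_successively[OF assms(2), where P = "(\<noteq>)" and R = "(\<noteq>)"])
      (use ij in \<open>auto simp: paths_iff distinct_adj_def\<close>)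
  with shuffle_length_set[OF assms(2)] ij show ?thesis
    by (auto simp: paths_iff)
qed

lemma keys_shuffles:
  assumes "keys t \<subseteq> product_paths k"
  shows "keys (shuffles t) \<subseteq> paths (X \<times> Y) k"
proof
  fix l assume "l \<in> keys (shuffles t)"
  then obtain p q where "(p, q) \<in> keys t" "l \<in> keys (shuffle p q)"
    unfolding shuffles_def by (auto elim!: frag_extend_keysE)
  then show "l \<in> paths (X \<times> Y) k" using assms shuffle_in_paths by blast
qed

lemma shuffles_no_Diag:
  assumes "l \<in> keys (shuffles t)"
  shows "Diag \<notin> set (word l)"
proof -
  obtain p q where "(p, q) \<in> keys t" "l \<in> keys (shuffle p q)"
    using assms unfolding shuffles_def by (auto elim!: frag_extend_keysE)
  then show ?thesis using shuffle_no_Diag by blast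
qed

text \<open>A point between two points with equal second coordinate has the same second coordinate, because
betweenness for the \<open>\<ell>\<^sup>1\<close> distance holds in each coordinate separately.\<close>

lemma horizontal_saturated:
  assumes "strictly_between_set X dX x x' = {}" "x \<in> X" "x' \<in> X" "y \<in> Y"
  shows "strictly_between_set (X \<times> Y) dXY (x, y) (x', y) = {}"
proof (rule equals0I)
  fix z assume z: "z \<in> strictly_between_set (X \<times> Y) dXY (x, y) (x', y)"
  obtain u v where uv: "z = (u, v)" by fastforce
  have mem: "u \<in> X" "v \<in> Y" and btw: "between dXY (x, y) (u, v) (x', y)"
    and ne: "(u, v) \<noteq> (x, y)" "(u, v) \<noteq> (x', y)"
    using z by (auto simp: strictly_between_set_def uv)
  note b = between_coordinates[OF btw assms(2) mem(1) assms(3,4) mem(2) assms(4)]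
  have "y = v" using MY.between_eq_iff[OF b(2) assms(4) mem(2) assms(4)] by blast
  then have "u \<in> strictly_between_set X dX x x'"
    using ne b(1) mem(1) by (auto simp: strictly_between_set_def)
  then show False using assms(1) by simp
qed

lemma vertical_saturated:
  assumes "strictly_between_set Y dY y y' = {}" "y \<in> Y" "y' \<in> Y" "x \<in> X"
  shows "strictly_between_set (X \<times> Y) dXY (x, y) (x, y') = {}"
proof (rule equals0I)
  fix z assume z: "z \<in> strictly_between_set (X \<times> Y) dXY (x, y) (x, y')"
  obtain u v where uv: "z = (u, v)" by fastforce
  have mem: "u \<in> X" "v \<in> Y" and btw: "between dXY (x, y) (u, v) (x, y')"
    and ne: "(u, v) \<noteq> (x, y)" "(u, v) \<noteq> (x, y')"
    using z by (auto simp: strictly_between_set_def uv)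
  note b = between_coordinates[OF btw assms(4) mem(1) assms(4,2) mem(2) assms(3)]
  have "x = u" using MX.between_eq_iff[OF b(1) assms(4) mem(1) assms(4)] by blast
  then have "v \<in> strictly_between_set Y dY y y'"
    using ne b(2) mem(2) by (auto simp: strictly_between_set_def)
  then show False using assms(1) by simp
qed

lemma shuffle_saturated:
  assumes "p \<in> saturated_paths X dX i" "q \<in> saturated_paths Y dY j" "l \<in> keys (shuffle p q)"
  shows "l \<in> saturated_paths (X \<times> Y) dXY (i + j)"
proof -
  have p: "p \<in> paths X i" "successively (\<lambda>a b. strictly_between_set X dX a b = {}) p"
    and q: "q \<in> paths Y j" "successively (\<lambda>a b. strictly_between_set Y dY a b = {}) q"
    using assms by (auto simp: saturated_paths_iff)
  have "successively (\<lambda>a b. strictly_between_set (X \<times> Y) dXY a b = {}) l"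
  proof (rule shuffle_successively[OF assms(3) p(2) q(2)])
    fix x x' y assume "strictly_between_set X dX x x' = {}" "x \<in> set p" "x' \<in> set p" "y \<in> set q"
    then show "strictly_between_set (X \<times> Y) dXY (x, y) (x', y) = {}"
      using p(1) q(1) by (intro horizontal_saturated) (auto simp: paths_iff)
  next
    fix x y y' assume "strictly_between_set Y dY y y' = {}" "x \<in> set p" "y \<in> set q" "y' \<in> set q"
    then show "strictly_between_set (X \<times> Y) dXY (x, y) (x, y') = {}"
      using p(1) q(1) by (intro vertical_saturated) (auto simp: paths_iff)
  qed
  then show ?thesis
    using shuffle_in_paths[OF product_pathsI[OF refl p(1) q(1)] assms(3)]
    by (simp add: saturated_paths_iff)
qed

text \<open>The coefficient of a pair \<open>(p, q)\<close> can be read off as the coefficient of its straight path.\<close>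

lemma shuffles_eq_0:
  assumes "keys t \<subseteq> product_paths k" "shuffles t = 0"
  shows "t = 0"
proof -
  have P0: "p \<noteq> [] \<and> q \<noteq> [] \<and> distinct_adj p \<and> distinct_adj q" if "(p, q) \<in> keys t" for p q
  proof -
    from that assms(1) have "(p, q) \<in> product_paths k" by blast
    then show ?thesis by (auto elim!: product_pathsE simp: paths_iff)
  qed
  have "keys t = {}"
  proof (rule equals0I)
    fix pq assume pq_in: "pq \<in> keys t"
    obtain p q where pq: "pq = (p, q)" by fastforce
    let ?l = "straight_path p q"
    note P = P0[OF pq_in[unfolded pq]]
    have coeff: "lookup (shuffle p' q') ?l = (if (p', q') = pq then 1 else 0)"
      if "(p', q') \<in> keys t" for p' q'
    proof -
      note P' = P0[OF that]
      obtain R where R: "shuffle p' q' = frag_of (straight_path p' q') + R"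
        "\<And>l. l \<in> keys R \<Longrightarrow> \<not> normal_word (word l)"
        using P' by (metis shuffle_straight_path)
      have "?l \<notin> keys R" using R(2) normal_straight_path P by blast
      moreover have "?l = straight_path p' q' \<longleftrightarrow> (p', q') = pq"
        using straight_path_inject[of p q p' q'] P P' pq by auto
      ultimately show ?thesis unfolding R(1) by (simp add: lookup_add in_keys_iff)
    qed
    have "lookup (shuffles t) ?l
        = (\<Sum>x\<in>keys t. lookup t x * lookup (case x of (p', q') \<Rightarrow> shuffle p' q') ?l)"
      unfolding shuffles_def by (rule lookup_frag_extend)
    also have "\<dots> = (\<Sum>x\<in>keys t. if x = pq then lookup t x else 0)"
      by (rule sum.cong) (auto simp: coeff)
    also have "\<dots> = lookup t pq"
      using pq_in by simp
    finally show False using assms(2) pq_in by (simp add: in_keys_iff)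
  qed
  then show ?thesis by simp
qed

text \<open>Subtracting shuffles removes the straight paths from a chain and brings in only upper paths.\<close>

lemma extract_straight:
  assumes "keys c \<subseteq> nonlower_paths k"
  shows "\<exists>t. keys t \<subseteq> product_paths k
    \<and> keys (c - shuffles t) \<subseteq> {\<sigma> \<in> nonlower_paths k. \<not> normal_word (word \<sigma>)}"
  using assms
proof (induction c rule: frag_induction)
  case zero
  show ?case by (rule exI[of _ 0]) simp
next
  case (one \<sigma>)
  show ?case
  proof (cases "normal_word (word \<sigma>)")
    case False
    then show ?thesis using one by (intro exI[of _ 0]) simp
  next
    case True
    have \<sigma>: "\<sigma> \<in> paths (X \<times> Y) k" using one by (simp add: nonlower_paths_def)
    then have *: "\<sigma> \<noteq> []" "distinct_adj \<sigma>" by (auto simp: paths_iff)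
    obtain p q where pq: "\<sigma> = straight_path p q" "p \<noteq> []" "q \<noteq> []" "distinct_adj p" "distinct_adj q"
      "set p \<subseteq> fst ` set \<sigma>" "set q \<subseteq> snd ` set \<sigma>"
      by (rule normal_wordE[OF True *])
    have len: "length \<sigma> = length p + length q - 1"
      unfolding pq(1) using pq(3) by (cases q) (auto simp: straight_path_def)
    have sub: "set p \<subseteq> X" "set q \<subseteq> Y" using pq(6,7) \<sigma> by (fastforce simp: paths_iff)+
    have "length p - 1 + (length q - 1) = k"
      using len \<sigma> pq(2,3) by (cases p; cases q) (auto simp: paths_iff)
    then have prod: "(p, q) \<in> product_paths k"
      by (rule product_pathsI) (use pq sub in \<open>auto simp: paths_iff\<close>)
    obtain R where R: "shuffle p q = frag_of (straight_path p q) + R"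
        "\<And>l. l \<in> keys R \<Longrightarrow> \<not> normal_word (word l)" "keys R \<subseteq> keys (shuffle p q)"
      using shuffle_straight_path[OF pq(2-5)] by blast
    have "keys R \<subseteq> {\<sigma> \<in> nonlower_paths k. \<not> normal_word (word \<sigma>)}"
    proof
      fix l assume l: "l \<in> keys R"
      then have "l \<in> keys (shuffle p q)" using R(3) by blast
      then have "l \<in> paths (X \<times> Y) k" "Diag \<notin> set (word l)"
        using shuffle_in_paths[OF prod] shuffle_no_Diag by blast+
      then show "l \<in> {\<sigma> \<in> nonlower_paths k. \<not> normal_word (word \<sigma>)}"
        using R(2)[OF l] lower_word_Diag by (auto simp: nonlower_paths_def)
    qed
    moreover have "frag_of \<sigma> - shuffles (frag_of (p, q)) = - R" using R(1) pq(1) by simp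
    ultimately show ?thesis using prod by (intro exI[of _ "frag_of (p, q)"]) simp
  qed
next
  case (diff a b)
  then obtain s t where st: "keys s \<subseteq> product_paths k" "keys t \<subseteq> product_paths k"
    "keys (a - shuffles s) \<subseteq> {\<sigma> \<in> nonlower_paths k. \<not> normal_word (word \<sigma>)}"
    "keys (b - shuffles t) \<subseteq> {\<sigma> \<in> nonlower_paths k. \<not> normal_word (word \<sigma>)}" by blast
  have eq: "a - b - shuffles (s - t) = (a - shuffles s) - (b - shuffles t)" by simp
  show ?case
    by (rule exI[of _ "s - t"], unfold eq) (intro conjI keys_diff_subset st)
qed

lemma keys_tensor_bd:
  assumes "keys t \<subseteq> product_paths k"
  shows "keys (tensor_bd t) \<subseteq> product_paths (k - 1)"
proof
  fix pq assume "pq \<in> keys (tensor_bd t)"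
  then obtain p q where pq: "(p, q) \<in> keys t"
    "pq \<in> keys (tensor (path_bd dX p) (frag_of q)
     + frag_cmul ((-1) ^ (length p - 1)) (tensor (frag_of p) (path_bd dY q)))"
    unfolding tensor_bd_def by (auto elim!: frag_extend_keysE)
  obtain i j where ij: "i + j = k" "p \<in> paths X i" "q \<in> paths Y j"
    using pq(1) assms product_pathsE[of p q k] by blast
  from pq(2) show "pq \<in> product_paths (k - 1)"
  proof (rule keys_addE)
    assume "pq \<in> keys (tensor (path_bd dX p) (frag_of q))"
    then obtain p' where p': "pq = (p', q)" "p' \<in> keys (path_bd dX p)"
      using keys_tensor[of "path_bd dX p" "frag_of q"] by auto
    then have "i \<noteq> 0" using ij by (auto simp: paths_iff length_Suc_conv)
    then show ?thesis
      using p' MX.keys_path_bd[OF ij(2)] ij by (auto intro!: product_pathsI[of "i - 1" j])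
  next
    assume "pq \<in> keys (frag_cmul ((-1) ^ (length p - 1)) (tensor (frag_of p) (path_bd dY q)))"
    then obtain q' where q': "pq = (p, q')" "q' \<in> keys (path_bd dY q)"
      using keys_tensor[of "frag_of p" "path_bd dY q"] by auto
    then have "j \<noteq> 0" using ij by (auto simp: paths_iff length_Suc_conv)
    then show ?thesis
      using q' MY.keys_path_bd[OF ij(3)] ij by (auto intro!: product_pathsI[of i "j - 1"])
  qed
qed

proposition cycle_homologous_to_shuffles:
  assumes c: "keys c \<subseteq> paths (X \<times> Y) k" "bd dXY c = 0"
  obtains t g where "keys t \<subseteq> product_paths k" "tensor_bd t = 0"
    "keys g \<subseteq> paths (X \<times> Y) (k + 1)" "c = shuffles t + bd dXY g"
proof -
  obtain g where g: "keys g \<subseteq> paths (X \<times> Y) (k + 1)" "keys (c - bd dXY g) \<subseteq> nonlower_paths k"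
    using chain_reducible[OF c(1)] unfolding reducible_def by blast
  obtain t where t: "keys t \<subseteq> product_paths k"
    "keys (c - bd dXY g - shuffles t) \<subseteq> {\<sigma> \<in> nonlower_paths k. \<not> normal_word (word \<sigma>)}"
    using extract_straight[OF g(2)] by blast
  \<comment> \<open>As shuffles contain no diagonal steps, this boundary contains no lower paths.\<close>
  have bd: "bd dXY (c - bd dXY g - shuffles t) = - shuffles (tensor_bd t)"
    using c(2) MXY.bd_bd[OF g(1)] bd_shuffles[OF t(1)] by simp
  have zero: "c - bd dXY g - shuffles t = 0"
  proof (rule upper_chain_eq_0)
    show "keys (c - bd dXY g - shuffles t) \<subseteq> paths (X \<times> Y) k"
      using t(2) by (auto simp: nonlower_paths_def)
    show "\<exists>a b. upper_word a b (word f)" if "f \<in> keys (c - bd dXY g - shuffles t)" for f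
    proof -
      have "\<not> normal_word (word f)" "\<And>a b. \<not> lower_word a b (word f)"
        using that t(2) by (auto simp: nonlower_paths_def)
      then show ?thesis by (metis word_cases)
    qed
    show "\<not> lower_word a b (word \<sigma>)" if "\<sigma> \<in> keys (bd dXY (c - bd dXY g - shuffles t))" for \<sigma> a b
    proof -
      have "\<sigma> \<in> keys (shuffles (tensor_bd t))" using that unfolding bd by simp
      then have "Diag \<notin> set (word \<sigma>)" by (rule shuffles_no_Diag)
      then show ?thesis using lower_word_Diag by blast
    qed
  qed
  then have "shuffles (tensor_bd t) = 0" using bd by simp
  then have "tensor_bd t = 0" by (rule shuffles_eq_0[OF keys_tensor_bd[OF t(1)]])
  moreover have "c = shuffles t + bd dXY g" using zero by (simp add: algebra_simps)
  ultimately show ?thesis using that t(1) g(1) by blast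
qed

end

section \<open>Saturating tensor cycles\<close>

text \<open>The slice \<open>slice_left q t\<close> is the coefficient of \<open>q\<close> when \<open>t\<close> is written as a sum of
\<open>t\<^sub>q \<otimes> q\<close>; \<open>slice_right\<close> is the same with the roles of the factors exchanged.\<close>

definition slice_left :: "'b \<Rightarrow> ('a \<times> 'b \<Rightarrow>\<^sub>0 int) \<Rightarrow> ('a \<Rightarrow>\<^sub>0 int)" where
  "slice_left q = frag_extend (\<lambda>(p, q'). if q' = q then frag_of p else 0)"

definition slice_right :: "'a \<Rightarrow> ('a \<times> 'b \<Rightarrow>\<^sub>0 int) \<Rightarrow> ('b \<Rightarrow>\<^sub>0 int)" where
  "slice_right p = frag_extend (\<lambda>(p', q). if p' = p then frag_of q else 0)"

lemma slice_left_simps [simp]: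
  "slice_left q 0 = 0"
  "slice_left q (frag_of (p, q')) = (if q' = q then frag_of p else 0)"
  "slice_left q (a - b) = slice_left q a - slice_left q b"
  "slice_left q (a + b) = slice_left q a + slice_left q b"
  "slice_left q (frag_cmul n a) = frag_cmul n (slice_left q a)"
  by (simp_all add: slice_left_def frag_extend_diff frag_extend_add frag_extend_cmul)

lemma slice_right_simps [simp]:
  "slice_right p 0 = 0"
  "slice_right p (frag_of (p', q)) = (if p' = p then frag_of q else 0)"
  "slice_right p (a - b) = slice_right p a - slice_right p b"
  "slice_right p (a + b) = slice_right p a + slice_right p b"
  "slice_right p (frag_cmul n a) = frag_cmul n (slice_right p a)"
  by (simp_all add: slice_right_def frag_extend_diff frag_extend_add frag_extend_cmul)

lemma lookup_slice_left [simp]: "lookup (slice_left q t) p = lookup t (p, q)"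
proof -
  have "keys t \<subseteq> UNIV" by simp
  then show ?thesis
    by (induction t rule: frag_induction) (auto simp: lookup_minus split: prod.splits if_splits)
qed

lemma lookup_slice_right [simp]: "lookup (slice_right p t) q = lookup t (p, q)"
proof -
  have "keys t \<subseteq> UNIV" by simp
  then show ?thesis
    by (induction t rule: frag_induction) (auto simp: lookup_minus split: prod.splits if_splits)
qed

lemma keys_slice_left: "p \<in> keys (slice_left q t) \<longleftrightarrow> (p, q) \<in> keys t"
  by (simp add: in_keys_iff)

lemma keys_slice_right: "q \<in> keys (slice_right p t) \<longleftrightarrow> (p, q) \<in> keys t"
  by (simp add: in_keys_iff)

lemma slice_left_tensor: "slice_left q (tensor u v) = frag_cmul (lookup v q) u"
  by (rule poly_mapping_eqI) (simp add: lookup_tensor mult.commute)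

lemma slice_right_tensor: "slice_right p (tensor u v) = frag_cmul (lookup u p) v"
  by (rule poly_mapping_eqI) (simp add: lookup_tensor)

lemma slice_left_sum: "finite I \<Longrightarrow> slice_left q (sum f I) = (\<Sum>i\<in>I. slice_left q (f i))"
  by (induction I rule: finite_induct) simp_all

lemma divisible_chain:
  assumes "\<And>q. g dvd lookup v q"
  obtains s where "v = frag_cmul g s" "keys s \<subseteq> keys v"
proof -
  let ?s = "Poly_Mapping.map (\<lambda>n. n div g) v"
  have l: "lookup ?s q = lookup v q div g" for q
    by (simp add: Poly_Mapping.map.rep_eq when_def)
  have "v = frag_cmul g ?s"
    by (rule poly_mapping_eqI) (simp add: l assms)
  moreover have "keys ?s \<subseteq> keys v"
    by (auto simp: in_keys_iff l)
  ultimately show ?thesis by (rule that)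
qed

text \<open>A nonzero subgroup of the integers is generated by its least positive element.\<close>

lemma additive_set_generator:
  fixes G :: "int set"
  assumes "\<And>a b. a \<in> G \<Longrightarrow> b \<in> G \<Longrightarrow> a - b \<in> G" "\<exists>a\<in>G. a \<noteq> 0"
  obtains g where "g \<in> G" "g \<noteq> 0" "\<forall>a\<in>G. g dvd a"
proof -
  have zero: "0 \<in> G" using assms by (metis diff_self)
  have neg: "- a \<in> G" if "a \<in> G" for a using assms(1)[OF zero that] by simp
  have add: "a + b \<in> G" if "a \<in> G" "b \<in> G" for a b
    using assms(1)[OF that(1) neg[OF that(2)]] by simp
  have nmult: "int n * a \<in> G" if "a \<in> G" for n a
    by (induction n) (use zero add that in \<open>auto simp: distrib_right\<close>)
  have mult: "n * a \<in> G" if "a \<in> G" for n a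
    using nmult[OF that, of "nat n"] nmult[OF neg[OF that], of "nat (- n)"] by (cases "n \<ge> 0") auto
  obtain a where "a \<in> G" "a > 0"
    using assms(2) neg by (metis neg_0_less_iff_less linorder_neqE)
  then have ex: "\<exists>n. n > 0 \<and> int n \<in> G" by (intro exI[of _ "nat a"]) simp
  define m where "m = (LEAST n. n > 0 \<and> int n \<in> G)"
  have m: "m > 0" "int m \<in> G" using LeastI_ex[OF ex] by (simp_all add: m_def)
  have "int m dvd a" if "a \<in> G" for a
  proof -
    have "a mod int m \<in> G"
      using assms(1)[OF that mult[OF m(2), of "a div int m"]] by (simp add: minus_div_mult_eq_mod)
    moreover have "a mod int m \<ge> 0" "a mod int m < int m" using m by simp_all
    moreover have "\<not> (nat (a mod int m) > 0 \<and> int (nat (a mod int m)) \<in> G)"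
      using not_less_Least[of "nat (a mod int m)" "\<lambda>n. n > 0 \<and> int n \<in> G"]
        \<open>a mod int m < int m\<close> \<open>a mod int m \<ge> 0\<close> unfolding m_def[symmetric] by linarith
    ultimately have "a mod int m = 0" by auto
    then show ?thesis by auto
  qed
  then show ?thesis using that[of "int m"] m by simp
qed

context metric_pair
begin

text \<open>The differential of the tensor complex split into the part acting on the first factor and the part
acting on the second.\<close>

definition tensor_bd_left where
  "tensor_bd_left = frag_extend (\<lambda>(p, q :: 'b list). tensor (path_bd dX p) (frag_of q))"

definition tensor_bd_right where
  "tensor_bd_right = frag_extend (\<lambda>(p :: 'a list, q).
     frag_cmul ((-1) ^ (length p - 1)) (tensor (frag_of p) (path_bd dY q)))"

lemma tensor_bd_split: "tensor_bd t = tensor_bd_left t + tensor_bd_right t"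
proof -
  have "keys t \<subseteq> UNIV" by simp
  then show ?thesis
    by (induction t rule: frag_induction)
      (auto simp: tensor_bd_left_def tensor_bd_right_def frag_extend_diff algebra_simps
        simp del: minus_frag_cmul)
qed

lemma slice_left_tensor_bd_left: "slice_left q (tensor_bd_left t) = bd dX (slice_left q t)"
proof -
  have "keys t \<subseteq> UNIV" by simp
  then show ?thesis
    by (induction t rule: frag_induction)
      (auto simp: tensor_bd_left_def frag_extend_diff slice_left_tensor)
qed

lemma slice_right_tensor_bd_right:
  "slice_right p (tensor_bd_right t) = frag_cmul ((-1) ^ (length p - 1)) (bd dY (slice_right p t))"
proof -
  have "keys t \<subseteq> UNIV" by simp
  then show ?thesis
    by (induction t rule: frag_induction)
      (auto simp: tensor_bd_right_def frag_extend_diff slice_right_tensor frag_cmul_diff_distrib2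
        simp del: minus_frag_cmul)
qed

lemma tensor_bd_tensor_bd:
  assumes "keys t \<subseteq> product_paths k"
  shows "tensor_bd (tensor_bd t) = 0"
  using assms
proof (induction t rule: frag_induction)
  case (one pq)
  then obtain p q i j where pq: "pq = (p, q)" "p \<in> paths X i" "q \<in> paths Y j"
    by (metis product_pathsE surj_pair)
  have i: "length p - Suc 0 = i" using pq by (simp add: paths_iff)
  have z: "bd dX (path_bd dX p) = 0" "bd dY (path_bd dY q) = 0"
    using pq by (simp_all add: paths_iff MX.bd_path_bd MY.bd_path_bd)
  have 1: "tensor_bd (tensor (path_bd dX p) (frag_of q))
      = frag_cmul ((-1) ^ (i - 1)) (tensor (path_bd dX p) (path_bd dY q))"
    using tensor_bd_tensor[OF MX.keys_path_bd[OF pq(2)], of "frag_of q"] z by simp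
  have 2: "tensor_bd (tensor (frag_of p) (path_bd dY q)) = tensor (path_bd dX p) (path_bd dY q)"
    using tensor_bd_tensor[of "frag_of p" i "path_bd dY q"] pq z by simp
  show ?case
  proof (cases i)
    case 0
    then have "path_bd dX p = 0" using pq by (auto simp: paths_iff length_Suc_conv)
    then show ?thesis using 2 by (simp add: pq i tensor_bd_cmul)
  next
    case (Suc i')
    then show ?thesis
      using 1 2 by (simp add: pq i tensor_bd_cmul minus_frag_cmul[symmetric] del: minus_frag_cmul)
  qed
qed simp_all

abbreviation saturated_left :: "'a list set" where
  "saturated_left \<equiv> (\<Union>i. saturated_paths X dX i)"

text \<open>The slice belongs to the group of saturated cycles of \<open>X\<close>, possibly of mixed degree.\<close>

definition good_slice :: "'b list \<Rightarrow> ('a list \<times> 'b list \<Rightarrow>\<^sub>0 int) \<Rightarrow> bool" where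
  "good_slice q t \<longleftrightarrow> keys (slice_left q t) \<subseteq> saturated_left \<and> bd dX (slice_left q t) = 0"

lemma keys_slice_left_paths:
  assumes "keys t \<subseteq> product_paths k" "q \<in> paths Y j"
  shows "keys (slice_left q t) \<subseteq> paths X (k - j)"
proof
  fix p assume "p \<in> keys (slice_left q t)"
  then have "(p, q) \<in> product_paths k" using assms(1) by (auto simp: keys_slice_left)
  then obtain i j' where "i + j' = k" "p \<in> paths X i" "q \<in> paths Y j'" by (rule product_pathsE)
  moreover from this have "j' = j" using assms(2) by (simp add: paths_iff)
  ultimately show "p \<in> paths X (k - j)" by auto
qed

lemma keys_slice_right_paths:
  assumes "keys t \<subseteq> product_paths k" "p \<in> paths X i"
  shows "keys (slice_right p t) \<subseteq> paths Y (k - i)"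
proof
  fix q assume "q \<in> keys (slice_right p t)"
  then have "(p, q) \<in> product_paths k" using assms(1) by (auto simp: keys_slice_right)
  then obtain i' j where "i' + j = k" "p \<in> paths X i'" "q \<in> paths Y j" by (rule product_pathsE)
  moreover from this have "i' = i" using assms(2) by (simp add: paths_iff)
  ultimately show "q \<in> paths Y (k - i)" by auto
qed

text \<open>Let \<open>q\<close> have \<open>m\<close> points. In the slice at \<open>q\<close> of the equation \<open>tensor_bd t = 0\<close>, the part
\<open>tensor_bd_right\<close> only involves slices at paths with \<open>m + 1\<close> points, which are saturated. Hence
the boundary of \<open>slice_left q t\<close> is saturated, so it is \<open>0\<close>, and diagonality of \<open>X\<close> makes the
slice saturated up to a boundary \<open>bd dX (b q)\<close>. Subtracting the differential of the sum of all
\<open>b q \<otimes> q\<close> corrects these slices and changes otherwise only slices at shorter paths.\<close>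

lemma improve_slices:
  assumes diag: "diagonal X dX"
    and t: "keys t \<subseteq> product_paths k" "tensor_bd t = 0"
    and good: "\<And>q. length q > m \<Longrightarrow> good_slice q t"
  obtains b where "keys b \<subseteq> product_paths (k + 1)"
    "\<forall>q. length q \<ge> m \<longrightarrow> good_slice q (t - tensor_bd b)"
proof -
  define Q where "Q = {q \<in> snd ` keys t. length q = m}"
  have finQ: "finite Q" by (simp add: Q_def)
  have "\<exists>b z i j. i + j = k \<and> q \<in> paths Y j \<and> keys b \<subseteq> paths X (i + 1)
      \<and> keys z \<subseteq> saturated_left \<and> bd dX z = 0 \<and> slice_left q t = z + bd dX b"
    if q: "q \<in> Q" for q
  proof -
    obtain p where pq: "(p, q) \<in> keys t" using q by (auto simp: Q_def)
    with t(1) have "(p, q) \<in> product_paths k" by blast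
    then obtain i j where ij: "i + j = k" "p \<in> paths X i" "q \<in> paths Y j" by (rule product_pathsE)
    have keys_q: "keys (slice_left q t) \<subseteq> paths X i"
      using keys_slice_left_paths[OF t(1) ij(3)] ij(1) by auto
    have "0 = slice_left q (tensor_bd t)" by (simp add: t(2))
    also have "\<dots> = bd dX (slice_left q t) + slice_left q (tensor_bd_right t)"
      by (simp add: tensor_bd_split slice_left_tensor_bd_left)
    finally have eq: "bd dX (slice_left q t) = - slice_left q (tensor_bd_right t)"
      by (simp add: eq_neg_iff_add_eq_0)
    have "keys (slice_left q (tensor_bd_right t)) \<subseteq> saturated_left"
    proof
      fix p' assume "p' \<in> keys (slice_left q (tensor_bd_right t))"
      then have "(p', q) \<in> keys (tensor_bd_right t)" by (simp add: keys_slice_left)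
      then obtain p1 q1 where 1: "(p1, q1) \<in> keys t"
        "(p', q) \<in> keys (frag_cmul ((-1) ^ (length p1 - 1)) (tensor (frag_of p1) (path_bd dY q1)))"
        unfolding tensor_bd_right_def by (auto elim!: frag_extend_keysE)
      then have 2: "p' = p1" "q \<in> keys (path_bd dY q1)"
        using keys_tensor[of "frag_of p1" "path_bd dY q1"] by auto
      then have "length q = length q1 - 1" using path_bd_keys[of q dY q1] by simp
      moreover have "q1 \<noteq> []" using 2 by auto
      ultimately have "length q1 > m" using q by (cases q1) (auto simp: Q_def)
      then have "keys (slice_left q1 t) \<subseteq> saturated_left" using good by (simp add: good_slice_def)
      then show "p' \<in> saturated_left" using 1 2 keys_slice_left[of p1 q1 t] by blast
    qed
    then have cycle: "bd dX (slice_left q t) = 0"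
      by (intro MX.saturated_boundary_eq_0[OF keys_q]) (simp add: eq)
    obtain z b where zb: "keys z \<subseteq> saturated_paths X dX i" "keys b \<subseteq> paths X (i + 1)"
      "slice_left q t = z + bd dX b"
      by (rule MX.diagonalE[OF diag keys_q cycle])
    have "bd dX z = 0"
      using cycle zb(3) MX.bd_bd[OF zb(2)] by simp
    then show ?thesis
      using zb ij by (intro exI[of _ b] exI[of _ z] exI[of _ i] exI[of _ j]) auto
  qed
  then obtain b z i j where bz: "\<And>q. q \<in> Q \<Longrightarrow> i q + j q = k \<and> q \<in> paths Y (j q)
      \<and> keys (b q) \<subseteq> paths X (i q + 1) \<and> keys (z q) \<subseteq> saturated_left \<and> bd dX (z q) = 0
      \<and> slice_left q t = z q + bd dX (b q)"
    by metis
  define B where "B = (\<Sum>q\<in>Q. tensor (b q) (frag_of q))"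
  have B: "keys B \<subseteq> product_paths (k + 1)"
  proof
    fix pq assume "pq \<in> keys B"
    then obtain q where q: "q \<in> Q" "pq \<in> keys (tensor (b q) (frag_of q))"
      unfolding B_def using keys_sum[of "\<lambda>q. tensor (b q) (frag_of q)" Q] by blast
    then obtain p where "pq = (p, q)" "p \<in> keys (b q)"
      using keys_tensor[of "b q" "frag_of q"] by auto
    then show "pq \<in> product_paths (k + 1)"
      using bz[OF q(1)] by (auto intro!: product_pathsI[of "i q + 1" "j q"])
  qed
  have slice_B: "slice_left q (tensor_bd B) = (if q \<in> Q then bd dX (b q) else 0)"
    if "length q \<ge> m" for q
  proof -
    have "slice_left q (tensor_bd (tensor (b q') (frag_of q'))) = (if q' = q then bd dX (b q) else 0)"
      if q': "q' \<in> Q" for q'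
    proof -
      have "q \<notin> keys (path_bd dY q')"
      proof
        assume "q \<in> keys (path_bd dY q')"
        then have "length q = length q' - 1" "q \<noteq> []" using path_bd_keys[of q dY q'] by auto
        then show False using \<open>length q \<ge> m\<close> q' by (cases q) (auto simp: Q_def)
      qed
      then show ?thesis
        using bz[OF q'] by (simp add: tensor_bd_tensor[of "b q'" "i q' + 1"] slice_left_tensor
            in_keys_iff)
    qed
    then have "slice_left q (tensor_bd B) = (\<Sum>q'\<in>Q. if q' = q then bd dX (b q) else 0)"
      unfolding B_def using finQ by (simp add: tensor_bd_sum slice_left_sum)
    then show ?thesis using finQ by simp
  qed
  have "good_slice q (t - tensor_bd B)" if len: "length q \<ge> m" for q
  proof (cases "q \<in> Q")
    case True
    then show ?thesis using bz[OF True] slice_B[OF len] by (simp add: good_slice_def)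
  next
    case False
    have eq: "slice_left q (t - tensor_bd B) = slice_left q t"
      using slice_B[OF len] False by simp
    show ?thesis
    proof (cases "length q = m")
      case True
      then have "keys (slice_left q t) = {}"
        using False by (force simp: Q_def keys_slice_left simp del: keys_eq_empty)
      then show ?thesis unfolding good_slice_def eq by simp
    next
      case ne: False
      then show ?thesis using good[of q] len unfolding good_slice_def eq by simp
    qed
  qed
  then show ?thesis using that B by blast
qed

lemma saturate_left:
  assumes diag: "diagonal X dX"
    and t: "keys t \<subseteq> product_paths k" "tensor_bd t = 0"
  obtains b where "keys b \<subseteq> product_paths (k + 1)" "\<And>q. good_slice q (t - tensor_bd b)"
proof -
  have "\<exists>b. keys b \<subseteq> product_paths (k + 1) \<and>
      (\<forall>q. length q + n \<ge> k + 2 \<longrightarrow> good_slice q (t - tensor_bd b))" if "n \<le> k + 2" for n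
    using that
  proof (induction n)
    case 0
    have "good_slice q t" if "length q \<ge> k + 2" for q
    proof -
      have "keys (slice_left q t) = {}"
      proof (rule equals0I)
        fix p assume "p \<in> keys (slice_left q t)"
        then have "(p, q) \<in> product_paths k" using t(1) by (auto simp: keys_slice_left)
        then show False using that by (auto elim!: product_pathsE simp: paths_iff)
      qed
      then show ?thesis by (simp add: good_slice_def)
    qed
    then show ?case by (intro exI[of _ 0]) simp
  next
    case (Suc n)
    then obtain b where b: "keys b \<subseteq> product_paths (k + 1)"
      "\<And>q. length q + n \<ge> k + 2 \<Longrightarrow> good_slice q (t - tensor_bd b)" by auto
    have 1: "keys (t - tensor_bd b) \<subseteq> product_paths k"
      using keys_diff_subset[OF t(1), of "tensor_bd b"] keys_tensor_bd[OF b(1)] by simp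
    have 2: "tensor_bd (t - tensor_bd b) = 0"
      using t(2) tensor_bd_tensor_bd[OF b(1)] by simp
    have 3: "good_slice q (t - tensor_bd b)" if "length q > k + 1 - n" for q
      using b(2) that by simp
    obtain b' where b': "keys b' \<subseteq> product_paths (k + 1)"
      "\<forall>q. length q \<ge> k + 1 - n \<longrightarrow> good_slice q (t - tensor_bd b - tensor_bd b')"
      by (rule improve_slices[OF diag 1 2 3]) blast
    have eq: "t - tensor_bd (b + b') = t - tensor_bd b - tensor_bd b'" by simp
    show ?case
    proof (rule exI[of _ "b + b'"], unfold eq, intro conjI allI impI)
      show "keys (b + b') \<subseteq> product_paths (k + 1)" by (rule keys_add_subset[OF b(1) b'(1)])
      show "good_slice q (t - tensor_bd b - tensor_bd b')" if "k + 2 \<le> length q + Suc n" for q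
        using that Suc.prems by (intro b'(2)[rule_format]) simp
    qed
  qed
  from this[of "k + 2"] show ?thesis using that by auto
qed

definition saturated_pairs :: "nat \<Rightarrow> ('a list \<times> 'b list) set" where
  "saturated_pairs k = (\<Union>i\<le>k. saturated_paths X dX i \<times> saturated_paths Y dY (k - i))"

text \<open>Induction on the finite set of paths of \<open>X\<close> that occur. For \<open>p\<close> among them, let \<open>g\<close> generate the
subgroup of all coefficients at \<open>p\<close> of saturated cycles supported on these paths, attained by the
cycle \<open>u\<close>. All coefficients of \<open>t\<close> at pairs \<open>(p, q)\<close> are multiples of \<open>g\<close>, say \<open>g\<close> times
those of \<open>s\<close>, and \<open>s\<close> is a cycle as its \<open>g\<close>-fold is one. Diagonality of \<open>Y\<close> saturates \<open>s\<close>
up to a boundary, hence also \<open>u \<otimes> s\<close>, while \<open>t - u \<otimes> s\<close> satisfies the same hypotheses and no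
longer involves \<open>p\<close>.\<close>

lemma saturate_right:
  assumes diag: "diagonal Y dY" and "finite P"
    and "keys t \<subseteq> product_paths k" "fst ` keys t \<subseteq> P"
    and "\<And>q. good_slice q t" "\<And>p. bd dY (slice_right p t) = 0"
  shows "\<exists>z b. keys z \<subseteq> saturated_pairs k \<and> keys b \<subseteq> product_paths (k + 1) \<and> t = z + tensor_bd b"
  using assms(2-)
proof (induction P arbitrary: t rule: finite_induct)
  case empty
  then have "t = 0" by simp
  then show ?case by (intro exI[of _ 0]) simp
next
  case (insert p P)
  show ?case
  proof (cases "p \<in> fst ` keys t")
    case False
    then have "fst ` keys t \<subseteq> P" using insert.prems(2) by blast
    then show ?thesis using insert.IH insert.prems by blast
  next
    case True
    then obtain q0 where pq0: "(p, q0) \<in> keys t" by auto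
    then have "(p, q0) \<in> product_paths k" using insert.prems(1) by blast
    then obtain i j where ij: "i + j = k" "p \<in> paths X i" "q0 \<in> paths Y j" by (rule product_pathsE)
    define U where "U = {u. keys u \<subseteq> insert p P \<inter> saturated_paths X dX i \<and> bd dX u = 0}"
    have U_diff: "u - v \<in> U" if "u \<in> U" "v \<in> U" for u v
      using that keys_diff_subset[of u _ v] unfolding U_def by simp
    have slice_U: "slice_left q t \<in> U" if "(p, q) \<in> keys t" for q
    proof -
      from that have "(p, q) \<in> product_paths k" using insert.prems(1) by blast
      then obtain i' j' where "i' + j' = k" "p \<in> paths X i'" "q \<in> paths Y j'" by (rule product_pathsE)
      then have q: "q \<in> paths Y j" using ij by (simp add: paths_iff)
      have "keys (slice_left q t) \<subseteq> paths X i"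
        using keys_slice_left_paths[OF insert.prems(1) q] ij(1) by auto
      moreover have "keys (slice_left q t) \<subseteq> saturated_left" "bd dX (slice_left q t) = 0"
        using insert.prems(3)[of q] by (simp_all add: good_slice_def)
      moreover have "keys (slice_left q t) \<subseteq> insert p P"
        using insert.prems(2) by (force simp: keys_slice_left)
      ultimately show ?thesis
        unfolding U_def by (fastforce simp: saturated_paths_def paths_iff)
    qed
    have slice_dvd_ex: "\<exists>a\<in>(\<lambda>u. lookup u p) ` U. a \<noteq> 0"
    proof (rule bexI)
      show "lookup (slice_left q0 t) p \<noteq> 0" using pq0 by (simp add: in_keys_iff)
      show "lookup (slice_left q0 t) p \<in> (\<lambda>u. lookup u p) ` U"
        by (rule imageI[OF slice_U[OF pq0]])
    qed
    obtain g where g: "g \<in> (\<lambda>u. lookup u p) ` U" "g \<noteq> 0"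
      "\<forall>a\<in>(\<lambda>u. lookup u p) ` U. g dvd a"
    proof (rule additive_set_generator[OF _ slice_dvd_ex])
      fix a b assume "a \<in> (\<lambda>u. lookup u p) ` U" "b \<in> (\<lambda>u. lookup u p) ` U"
      then obtain u v where "u \<in> U" "v \<in> U" "a = lookup u p" "b = lookup v p" by auto
      then show "a - b \<in> (\<lambda>u. lookup u p) ` U"
        by (intro image_eqI[of _ _ "u - v"]) (simp_all add: U_diff lookup_minus)
    qed
    obtain u where u: "u \<in> U" "lookup u p = g" using g(1) by auto
    have u_sat: "keys u \<subseteq> saturated_paths X dX i" "keys u \<subseteq> insert p P" "bd dX u = 0"
      using u(1) by (auto simp: U_def)
    have u_paths: "keys u \<subseteq> paths X i" using u_sat by (auto simp: saturated_paths_def)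
    have "g dvd lookup (slice_right p t) q" for q
    proof (cases "(p, q) \<in> keys t")
      case True
      have "lookup (slice_left q t) p \<in> (\<lambda>u. lookup u p) ` U"
        by (rule imageI[OF slice_U[OF True]])
      with g(3) have "g dvd lookup (slice_left q t) p" by (rule bspec)
      then show ?thesis by simp
    qed (simp add: in_keys_iff)
    then obtain s where s: "slice_right p t = frag_cmul g s" "keys s \<subseteq> keys (slice_right p t)"
      by (rule divisible_chain)
    have s_paths: "keys s \<subseteq> paths Y j"
      using s(2) keys_slice_right_paths[OF insert.prems(1) ij(2)] ij(1) by auto
    have "frag_cmul g (bd dY s) = 0" using insert.prems(4)[of p] s(1) by simp
    then have bd_s: "bd dY s = 0" using g(2) by simp
    obtain z b where zb: "keys z \<subseteq> saturated_paths Y dY j" "keys b \<subseteq> paths Y (j + 1)"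
      "s = z + bd dY b"
      by (rule MY.diagonalE[OF diag s_paths bd_s])
    define t' where "t' = t - tensor u s"
    have lookup_t: "lookup t (p, q) = g * lookup s q" for q
      using arg_cong[OF s(1), of "\<lambda>c. lookup c q"] by simp
    have us_paths: "keys (tensor u s) \<subseteq> product_paths k"
    proof
      fix pq assume "pq \<in> keys (tensor u s)"
      then obtain p' q' where "pq = (p', q')" "p' \<in> keys u" "q' \<in> keys s"
        using keys_tensor[of u s] by blast
      then show "pq \<in> product_paths k" using u_paths s_paths ij(1) by (auto intro!: product_pathsI[of i j])
    qed
    have "\<exists>z b. keys z \<subseteq> saturated_pairs k \<and> keys b \<subseteq> product_paths (k + 1) \<and> t' = z + tensor_bd b"
    proof (rule insert.IH)
      show "keys t' \<subseteq> product_paths k"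
        unfolding t'_def by (rule keys_diff_subset[OF insert.prems(1) us_paths])
      show "fst ` keys t' \<subseteq> P"
      proof
        fix p' assume "p' \<in> fst ` keys t'"
        then obtain q' where k: "(p', q') \<in> keys t'" by auto
        then have "p' \<noteq> p"
          using u(2) lookup_t by (auto simp: t'_def in_keys_iff lookup_minus lookup_tensor)
        moreover from k have "(p', q') \<in> keys t \<or> (p', q') \<in> keys (tensor u s)"
          unfolding t'_def by (auto elim: keys_diffE)
        then have "p' \<in> insert p P"
          using insert.prems(2) u_sat(2) keys_tensor[of u s] by force
        ultimately show "p' \<in> P" by blast
      qed
      show "good_slice q t'" for q
        using insert.prems(3)[of q] u_sat
          keys_diff_subset[of "slice_left q t" saturated_left "frag_cmul (lookup s q) u"]
          keys_cmul[of "lookup s q" u]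
        unfolding good_slice_def t'_def by (auto simp: slice_left_tensor)
      show "bd dY (slice_right p' t') = 0" for p'
        using insert.prems(4)[of p'] bd_s by (simp add: t'_def slice_right_tensor)
    qed
    then obtain z' b' where zb': "keys z' \<subseteq> saturated_pairs k" "keys b' \<subseteq> product_paths (k + 1)"
      "t' = z' + tensor_bd b'" by blast
    let ?b = "frag_cmul ((-1) ^ i) (tensor u b)"
    have "tensor_bd ?b = tensor u (bd dY b)"
      using u_sat(3) by (simp add: tensor_bd_cmul tensor_bd_tensor[OF u_paths] flip: power_add mult_2)
    then have eq: "t = (z' + tensor u z) + tensor_bd (b' + ?b)"
      using zb'(3) zb(3) by (simp add: t'_def algebra_simps)
    have "keys (tensor u z) \<subseteq> saturated_pairs k"
    proof
      fix pq assume "pq \<in> keys (tensor u z)"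
      then obtain p' q' where "pq = (p', q')" "p' \<in> keys u" "q' \<in> keys z"
        using keys_tensor[of u z] by blast
      then show "pq \<in> saturated_pairs k"
        using u_sat(1) zb(1) ij(1) unfolding saturated_pairs_def
        by (auto intro!: bexI[of _ i])
    qed
    moreover have "keys ?b \<subseteq> product_paths (k + 1)"
    proof
      fix pq assume "pq \<in> keys ?b"
      then obtain p' q' where "pq = (p', q')" "p' \<in> keys u" "q' \<in> keys b"
        using keys_tensor[of u b] by auto
      then show "pq \<in> product_paths (k + 1)"
        using u_paths zb(2) ij(1) by (auto intro!: product_pathsI[of i "j + 1"])
    qed
    ultimately show ?thesis
      using eq keys_add_subset[OF zb'(1), of "tensor u z"] keys_add_subset[OF zb'(2), of ?b] by blast
  qed
qed

proposition tensor_cycle_saturated: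
  assumes "diagonal X dX" "diagonal Y dY" "keys t \<subseteq> product_paths k" "tensor_bd t = 0"
  obtains z b where "keys z \<subseteq> saturated_pairs k" "keys b \<subseteq> product_paths (k + 1)"
    "t = z + tensor_bd b"
proof -
  obtain b where b: "keys b \<subseteq> product_paths (k + 1)" "\<And>q. good_slice q (t - tensor_bd b)"
    by (rule saturate_left[OF assms(1,3,4)]) blast
  define t' where "t' = t - tensor_bd b"
  have t': "keys t' \<subseteq> product_paths k"
    unfolding t'_def by (rule keys_diff_subset[OF assms(3)]) (use keys_tensor_bd[OF b(1)] in simp)
  have bd: "tensor_bd t' = 0"
    using assms(4) tensor_bd_tensor_bd[OF b(1)] by (simp add: t'_def)
  have "tensor_bd_left t' = 0"
  proof (rule poly_mapping_eqI)
    fix pq :: "'a list \<times> 'b list"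
    obtain p q where pq: "pq = (p, q)" by fastforce
    have "slice_left q (tensor_bd_left t') = 0"
      using b(2)[of q] by (simp add: slice_left_tensor_bd_left t'_def[symmetric] good_slice_def)
    then have "lookup (slice_left q (tensor_bd_left t')) p = 0" by simp
    then show "lookup (tensor_bd_left t') pq = lookup 0 pq" by (simp add: pq)
  qed
  then have right: "tensor_bd_right t' = 0" using bd by (simp add: tensor_bd_split)
  have "bd dY (slice_right p t') = 0" for p
  proof -
    have "frag_cmul ((-1) ^ (length p - 1)) (bd dY (slice_right p t')) = 0"
      using slice_right_tensor_bd_right[of p t'] right by simp
    then show ?thesis by simp
  qed
  then obtain z b' where "keys z \<subseteq> saturated_pairs k" "keys b' \<subseteq> product_paths (k + 1)"
    "t' = z + tensor_bd b'"
    using saturate_right[OF assms(2) _ t' subset_refl b(2)[folded t'_def]] by auto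
  then show ?thesis
    using that[of z "b + b'"] keys_add_subset[OF b(1), of b'] by (simp add: t'_def algebra_simps)
qed

proposition diagonal_product:
  assumes "diagonal X dX" "diagonal Y dY"
  shows "diagonal (X \<times> Y) dXY"
  unfolding MXY.diagonal_iff
proof (intro allI impI)
  fix k c assume c: "keys c \<subseteq> paths (X \<times> Y) k" "bd dXY c = 0"
  obtain t g where t: "keys t \<subseteq> product_paths k" "tensor_bd t = 0"
    "keys g \<subseteq> paths (X \<times> Y) (k + 1)" "c = shuffles t + bd dXY g"
    by (rule cycle_homologous_to_shuffles[OF c])
  obtain z b where zb: "keys z \<subseteq> saturated_pairs k" "keys b \<subseteq> product_paths (k + 1)"
    "t = z + tensor_bd b"
    by (rule tensor_cycle_saturated[OF assms t(1,2)])
  have "keys (shuffles z) \<subseteq> saturated_paths (X \<times> Y) dXY k"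
  proof
    fix l assume "l \<in> keys (shuffles z)"
    then obtain p q where pq: "(p, q) \<in> keys z" "l \<in> keys (shuffle p q)"
      unfolding shuffles_def by (auto elim!: frag_extend_keysE)
    then obtain i where "i \<le> k" "p \<in> saturated_paths X dX i" "q \<in> saturated_paths Y dY (k - i)"
      using zb(1) by (auto simp: saturated_pairs_def)
    then show "l \<in> saturated_paths (X \<times> Y) dXY k"
      using shuffle_saturated[of p i q "k - i" l] pq(2) by simp
  qed
  moreover have "c = shuffles z + bd dXY (shuffles b + g)"
    using t(4) zb(3) bd_shuffles[OF zb(2)] by (simp add: algebra_simps)
  moreover have "keys (shuffles b + g) \<subseteq> paths (X \<times> Y) (k + 1)"
    by (rule keys_add_subset[OF keys_shuffles[OF zb(2)] t(3)])
  ultimately show "\<exists>z b. keys z \<subseteq> saturated_paths (X \<times> Y) dXY k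
      \<and> keys b \<subseteq> paths (X \<times> Y) (k + 1) \<and> c = z + bd dXY b"
    by blast
qed

end

theorem proposition4p8:
  fixes X :: "'a set" and dX :: "'a \<Rightarrow> 'a \<Rightarrow> real"
    and Y :: "'b set" and dY :: "'b \<Rightarrow> 'b \<Rightarrow> real"
  assumes "Metric_space X dX" and "diagonal X dX"
    and "Metric_space Y dY" and "diagonal Y dY"
  shows "diagonal (X \<times> Y) (l1_dist dX dY)"
proof -
  interpret metric_pair X dX Y dY
    by (intro metric_pair.intro assms)
  show ?thesis by (rule diagonal_product[OF assms(2,4)])
qed

end
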